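(* Let $X$ be a set, $[\,]$ a horizontal-tribracket on $X$, $\langle\,\rangle$ the corresponding vertical-tribracket, and $A$ an abelian group. Let $H^{\rm LB}$ denote the local biquandle (co)homology of the local biquandle corresponding to $(X,[\,])$, and let $H^{\rm N}$ denote Niebrzydowski's (knot-theoretic ternary quasigroup) (co)homology of $(X,\langle\,\rangle)$. Then for every $n\in\mathbb Z$, $$H_n^{\rm LB}(X;A)\cong H_{n-1}^{\rm N}(X;A)\quad\text{and}\quad H^n_{\rm LB}(X;A)\cong H^{n-1}_{\rm N}(X;A).$$
   Context: **Tribrackets.** A horizontal-tribracket on a set $X$ is a map $[\,]:X^3\to X$, $(a,b,c)\mapsto[a,b,c]$, such that: ($\mathcal H$1) for all $a,b,c\in X$ there are a unique $d_1$ with $[a,b,d_1]=c$, a unique $d_2$ with $[a,d_2,b]=c$, and a unique $d_3$ with $[d_3,a,b]=c$; ($\mathcal H$2) for all $a,b,c,d\in X$, $[b,[a,b,c],[a,b,d]]=[c,[a,b,c],[a,c,d]]=[d,[a,b,d],[a,c,d]]$. The corresponding vertical-tribracket $\langle\,\rangle:X^3\to X$ is defined by letting $\langle a,b,c\rangle$ be the unique $d$ with $[a,b,d]=c$. The local biquandle corresponding to $(X,[\,])$ has operations $(a,b)\,\underline{\star}\,(a,c)=(c,[a,b,c])$ and $(a,b)\,\overline{\star}\,(a,c)=(c,[a,c,b])$, defined on pairs of elements of $X^2$ with the same first component. **Local biquandle (co)homology.** For $n\ge1$ let $C_n(X)$ be the free $\mathbb Z$-module on $\bigcup_{a\in X}(\{a\}\times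 X)^n=\{((a,b_1),\dots,(a,b_n))\mid a,b_1,\dots,b_n\in X\}$, and $C_n(X)=0$ for $n\le0$. For $n\ge2$, $$\partial_n\big((a,b_1),\dots,(a,b_n)\big)=\sum_{i=1}^n(-1)^i\Big\{\big((a,b_1),\dots,\widehat{(a,b_i)},\dots,(a,b_n)\big)-\big((b_i,[a,b_1,b_i]),\dots,(b_i,[a,b_{i-1},b_i]),(b_i,[a,b_i,b_{i+1}]),\dots,(b_i,[a,b_i,b_n])\big)\Big\},$$ and $\partial_n=0$ for $n\le 1$. Let $D_n(X)\subset C_n(X)$ be the submodule generated by the tuples with $b_i=b_{i+1}$ for some $i\in\{1,\dots,n-1\}$. These form a chain complex and a subcomplex; put $C^{\rm LB}_n(X)=C_n(X)/D_n(X)$ with induced boundary $\partial^{\rm LB}_n$. **Niebrzydowski's (co)homology.** For $n\ge0$ let $C_n^{\rm Nie}(X)$ be the free $\mathbb Z$-module on $X^{n+2}$, and $C^{\rm Nie}_n(X)=0$ for $n<0$. For $n>0$, $$\partial_n^{\rm Nie}(a_0,\dots,a_{n+1})=\sum_{i=0}^n(-1)^i\Big\{(y_{(i,1)},\dots,y_{(i,i)},a_{i+1},\dots,a_{n+1})-(a_0,\dots,a_i,y_{(i,i+1)},\dots,y_{(i,n)})\Big\},$$ where $y_{(i,j)}=\langle a_{j-1},a_j,y_{(i,j+1)}\rangle$ if $j<i$, $y_{(i,j)}=\langle a_{j-1},a_j,a_{j+1}\rangle$ if $j\in\{i,i+1\}$, and $y_{(i,j)}=\langle y_{(i,j-1)},a_j,a_{j+1}\rangle$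 if $j>i+1$; and $\partial^{\rm Nie}_n=0$ for $n\le0$. Let $D^{\rm Nie}_n(X)$ be generated by the tuples with $\langle a_{j-1},a_j,a_{j+1}\rangle=a_j$ for some $j\in\{1,\dots,n\}$. These form a chain complex and a subcomplex; put $C^{\rm N}_n(X)=C^{\rm Nie}_n(X)/D^{\rm Nie}_n(X)$ with induced boundary $\partial^{\rm N}_n$. **Coefficients.** For $\bullet\in\{{\rm LB},{\rm N}\}$, $H_n^\bullet(X;A)$ is the homology of $C^\bullet_*(X)\otimes A$, and $H^n_\bullet(X;A)$ is the cohomology of ${\rm Hom}(C^\bullet_*(X),A)$ with $\delta^n(f)=f\circ\partial^\bullet_{n+1}$. *)

theory Defs
  imports "HOL-Algebra.Free_Abelian_Groups"
begin

subsection \<open>Tribrackets\<close>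

locale horizontal_tribracket =
  fixes X :: "'x set" and br :: "'x \<Rightarrow> 'x \<Rightarrow> 'x \<Rightarrow> 'x"
  assumes closed: "\<lbrakk>a \<in> X; b \<in> X; c \<in> X\<rbrakk> \<Longrightarrow> br a b c \<in> X"
    and H1_right: "\<lbrakk>a \<in> X; b \<in> X; c \<in> X\<rbrakk> \<Longrightarrow> \<exists>!d. d \<in> X \<and> br a b d = c"
    and H1_middle: "\<lbrakk>a \<in> X; b \<in> X; c \<in> X\<rbrakk> \<Longrightarrow> \<exists>!d. d \<in> X \<and> br a d b = c"
    and H1_left: "\<lbrakk>a \<in> X; b \<in> X; c \<in> X\<rbrakk> \<Longrightarrow> \<exists>!d. d \<in> X \<and> br d a b = c"
    and H2: "\<lbrakk>a \<in> X; b \<in> X; c \<in> X; d \<in> X\<rbrakk> \<Longrightarrow>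
      br b (br a b c) (br a b d) = br c (br a b c) (br a c d) \<and>
      br c (br a b c) (br a c d) = br d (br a b d) (br a c d)"

definition vertical_tribracket ::
  "'x set \<Rightarrow> ('x \<Rightarrow> 'x \<Rightarrow> 'x \<Rightarrow> 'x) \<Rightarrow> 'x \<Rightarrow> 'x \<Rightarrow> 'x \<Rightarrow> 'x" where
  "vertical_tribracket X br a b c = (THE d. d \<in> X \<and> br a b d = c)"

text \<open>The operations of the corresponding local biquandle; they are only meaningful on pairs
  with equal first components, so reading that component off the first argument is no loss.\<close>

definition lb_under :: "('x \<Rightarrow> 'x \<Rightarrow> 'x \<Rightarrow> 'x) \<Rightarrow> 'x \<times> 'x \<Rightarrow> 'x \<times> 'x \<Rightarrow> 'x \<times> 'x" where
  "lb_under br p q = (snd q, br (fst p) (snd p) (snd q))"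

definition lb_over :: "('x \<Rightarrow> 'x \<Rightarrow> 'x \<Rightarrow> 'x) \<Rightarrow> 'x \<times> 'x \<Rightarrow> 'x \<times> 'x \<Rightarrow> 'x \<times> 'x" where
  "lb_over br p q = (snd q, br (fst p) (snd q) (snd p))"

subsection \<open>Complexes of abelian groups\<close>

text \<open>Abelian groups are HOL-Algebra groups, written multiplicatively. A chain (cochain) complex
  is given by groups \<open>C n\<close> and maps \<open>d n : C n \<rightarrow> C (n - 1)\<close> (\<open>d n : C n \<rightarrow> C (n + 1)\<close>),
  \<open>n\<close> an integer; only the values of \<open>d n\<close> on the carrier of \<open>C n\<close> matter.\<close>

definition homology ::
  "(int \<Rightarrow> 'c monoid) \<Rightarrow> (int \<Rightarrow> 'c \<Rightarrow> 'c) \<Rightarrow> int \<Rightarrow> 'c set monoid" where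
  "homology C d n =
     (C n)\<lparr>carrier := kernel (C n) (C (n - 1)) (d n)\<rparr> Mod (d (n + 1) ` carrier (C (n + 1)))"

definition cohomology ::
  "(int \<Rightarrow> 'c monoid) \<Rightarrow> (int \<Rightarrow> 'c \<Rightarrow> 'c) \<Rightarrow> int \<Rightarrow> 'c set monoid" where
  "cohomology C d n =
     (C n)\<lparr>carrier := kernel (C n) (C (n + 1)) (d n)\<rparr> Mod (d (n - 1) ` carrier (C (n - 1)))"

text \<open>The map \<open>G Mod M \<rightarrow> H Mod N\<close> induced by a homomorphism \<open>f : G \<rightarrow> H\<close> with \<open>f ` M \<subseteq> N\<close>:
  the coset of \<open>x\<close> goes to the coset of \<open>f x\<close>.\<close>

definition induced_map ::
  "('h, 'm) monoid_scheme \<Rightarrow> 'h set \<Rightarrow> ('g \<Rightarrow> 'h) \<Rightarrow> 'g set \<Rightarrow> 'h set" where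
  "induced_map H N f K = the_elem ((\<lambda>x. N #>\<^bsub>H\<^esub> f x) ` K)"

text \<open>The tensor product over the integers: the free abelian group on pairs, modulo
  biadditivity.\<close>

definition tensor_relations ::
  "('g, 'm) monoid_scheme \<Rightarrow> ('a, 'k) monoid_scheme \<Rightarrow> ('g \<times> 'a \<Rightarrow>\<^sub>0 int) set" where
  "tensor_relations G A =
     generate (free_Abelian_group (carrier G \<times> carrier A))
       ({frag_of (x \<otimes>\<^bsub>G\<^esub> y, a) - (frag_of (x, a) + frag_of (y, a)) | x y a.
           x \<in> carrier G \<and> y \<in> carrier G \<and> a \<in> carrier A}
        \<union> {frag_of (x, a \<otimes>\<^bsub>A\<^esub> b) - (frag_of (x, a) + frag_of (x, b)) | x a b.
           x \<in> carrier G \<and> a \<in> carrier A \<and> b \<in> carrier A})"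

definition tensor_group ::
  "('g, 'm) monoid_scheme \<Rightarrow> ('a, 'k) monoid_scheme \<Rightarrow> ('g \<times> 'a \<Rightarrow>\<^sub>0 int) set monoid" where
  "tensor_group G A =
     free_Abelian_group (carrier G \<times> carrier A) Mod tensor_relations G A"

text \<open>The homomorphism \<open>f \<otimes> id : G \<otimes> A \<rightarrow> H \<otimes> A\<close>, where \<open>H\<close> is the codomain of \<open>f\<close>.\<close>

definition tensor_map ::
  "('h, 'm) monoid_scheme \<Rightarrow> ('a, 'k) monoid_scheme \<Rightarrow> ('g \<Rightarrow> 'h) \<Rightarrow>
     ('g \<times> 'a \<Rightarrow>\<^sub>0 int) set \<Rightarrow> ('h \<times> 'a \<Rightarrow>\<^sub>0 int) set" where
  "tensor_map H A f =
     induced_map (free_Abelian_group (carrier H \<times> carrier A)) (tensor_relations H A)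
       (frag_extend (\<lambda>(x, a). frag_of (f x, a)))"

text \<open>Homomorphisms are represented extensionally, so that two of them are equal as soon as
  they agree on the carrier.\<close>

definition hom_group ::
  "('g, 'm) monoid_scheme \<Rightarrow> ('a, 'k) monoid_scheme \<Rightarrow> ('g \<Rightarrow> 'a) monoid" where
  "hom_group G A =
     \<lparr>carrier = hom G A \<inter> extensional (carrier G),
      monoid.mult = (\<lambda>f g. \<lambda>x\<in>carrier G. f x \<otimes>\<^bsub>A\<^esub> g x),
      one = (\<lambda>x\<in>carrier G. \<one>\<^bsub>A\<^esub>)\<rparr>"

definition homology_coeff ::
  "(int \<Rightarrow> 'c monoid) \<Rightarrow> (int \<Rightarrow> 'c \<Rightarrow> 'c) \<Rightarrow> ('a, 'k) monoid_scheme \<Rightarrow> int \<Rightarrow>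
     ('c \<times> 'a \<Rightarrow>\<^sub>0 int) set set monoid" where
  "homology_coeff C d A =
     homology (\<lambda>n. tensor_group (C n) A) (\<lambda>n. tensor_map (C (n - 1)) A (d n))"

definition cohomology_coeff ::
  "(int \<Rightarrow> 'c monoid) \<Rightarrow> (int \<Rightarrow> 'c \<Rightarrow> 'c) \<Rightarrow> ('a, 'k) monoid_scheme \<Rightarrow> int \<Rightarrow>
     ('c \<Rightarrow> 'a) set monoid" where
  "cohomology_coeff C d A =
     cohomology (\<lambda>n. hom_group (C n) A) (\<lambda>n f. \<lambda>x\<in>carrier (C (n + 1)). f (d (n + 1) x))"

definition quotient_groups ::
  "(int \<Rightarrow> 'c monoid) \<Rightarrow> (int \<Rightarrow> 'c set) \<Rightarrow> int \<Rightarrow> 'c set monoid" where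
  "quotient_groups C D n = C n Mod D n"

definition quotient_boundary ::
  "(int \<Rightarrow> 'c monoid) \<Rightarrow> (int \<Rightarrow> 'c set) \<Rightarrow> (int \<Rightarrow> 'c \<Rightarrow> 'c) \<Rightarrow> int \<Rightarrow> 'c set \<Rightarrow> 'c set" where
  "quotient_boundary C D d n = induced_map (C (n - 1)) (D (n - 1)) (d n)"

subsection \<open>Local biquandle (co)homology\<close>

text \<open>The basis element \<open>((a, b\<^sub>1), \<dots>, (a, b\<^sub>n))\<close> is the list \<open>map (Pair a) [b\<^sub>1, \<dots>, b\<^sub>n]\<close>.\<close>

definition lb_basis :: "'x set \<Rightarrow> int \<Rightarrow> ('x \<times> 'x) list set" where
  "lb_basis X n =
     (if n \<ge> 1 then {map (Pair a) bs | a bs. a \<in> X \<and> set bs \<subseteq> X \<and> int (length bs) = n} else {})"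

definition lb_chain :: "'x set \<Rightarrow> int \<Rightarrow> (('x \<times> 'x) list \<Rightarrow>\<^sub>0 int) monoid" where
  "lb_chain X n = free_Abelian_group (lb_basis X n)"

text \<open>Indices in the formula start at \<open>1\<close>, list positions at \<open>0\<close>: the \<open>i\<close>-th entry is
  \<open>ps ! (i - 1)\<close>, and the entries before and after it are \<open>take (i - 1) ps\<close> and \<open>drop i ps\<close>.\<close>

definition lb_boundary_basis ::
  "('x \<Rightarrow> 'x \<Rightarrow> 'x \<Rightarrow> 'x) \<Rightarrow> ('x \<times> 'x) list \<Rightarrow> (('x \<times> 'x) list \<Rightarrow>\<^sub>0 int)" where
  "lb_boundary_basis br ps =
     (\<Sum>i = 1..length ps. frag_cmul ((- 1) ^ i)
        (frag_of (take (i - 1) ps @ drop i ps)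
         - frag_of (map (\<lambda>p. lb_under br p (ps ! (i - 1))) (take (i - 1) ps)
                    @ map (\<lambda>p. lb_over br p (ps ! (i - 1))) (drop i ps))))"

lemma lb_boundary_basis_explicit:
  "lb_boundary_basis br (map (Pair a) bs) =
     (\<Sum>i = 1..length bs. frag_cmul ((- 1) ^ i)
        (frag_of (map (Pair a) (take (i - 1) bs @ drop i bs))
         - frag_of (map (\<lambda>b. (bs ! (i - 1), br a b (bs ! (i - 1)))) (take (i - 1) bs)
                    @ map (\<lambda>b. (bs ! (i - 1), br a (bs ! (i - 1)) b)) (drop i bs))))"
  unfolding lb_boundary_basis_def
  by (rule sum.cong) (auto simp: lb_under_def lb_over_def take_map drop_map comp_def)

definition lb_boundary ::
  "('x \<Rightarrow> 'x \<Rightarrow> 'x \<Rightarrow> 'x) \<Rightarrow> int \<Rightarrow> (('x \<times> 'x) list \<Rightarrow>\<^sub>0 int) \<Rightarrow> (('x \<times> 'x) list \<Rightarrow>\<^sub>0 int)" where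
  "lb_boundary br n = (if n \<ge> 2 then frag_extend (lb_boundary_basis br) else (\<lambda>_. 0))"

definition lb_degenerate :: "'x set \<Rightarrow> int \<Rightarrow> (('x \<times> 'x) list \<Rightarrow>\<^sub>0 int) set" where
  "lb_degenerate X n =
     generate (lb_chain X n)
       (frag_of ` {ps \<in> lb_basis X n. \<exists>i. Suc i < length ps \<and> snd (ps ! i) = snd (ps ! Suc i)})"

abbreviation lb_groups :: "'x set \<Rightarrow> int \<Rightarrow> (('x \<times> 'x) list \<Rightarrow>\<^sub>0 int) set monoid" where
  "lb_groups X \<equiv> quotient_groups (lb_chain X) (lb_degenerate X)"

abbreviation lb_diff ::
  "'x set \<Rightarrow> ('x \<Rightarrow> 'x \<Rightarrow> 'x \<Rightarrow> 'x) \<Rightarrow> int \<Rightarrow>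
     (('x \<times> 'x) list \<Rightarrow>\<^sub>0 int) set \<Rightarrow> (('x \<times> 'x) list \<Rightarrow>\<^sub>0 int) set" where
  "lb_diff X br \<equiv> quotient_boundary (lb_chain X) (lb_degenerate X) (lb_boundary br)"

definition lb_homology where
  "lb_homology X br A n = homology_coeff (lb_groups X) (lb_diff X br) A n"

definition lb_cohomology where
  "lb_cohomology X br A n = cohomology_coeff (lb_groups X) (lb_diff X br) A n"

subsection \<open>Niebrzydowski's (co)homology\<close>

definition nie_basis :: "'x set \<Rightarrow> int \<Rightarrow> 'x list set" where
  "nie_basis X n = (if n \<ge> 0 then {as. set as \<subseteq> X \<and> int (length as) = n + 2} else {})"

definition nie_chain :: "'x set \<Rightarrow> int \<Rightarrow> ('x list \<Rightarrow>\<^sub>0 int) monoid" where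
  "nie_chain X n = free_Abelian_group (nie_basis X n)"

text \<open>The elements \<open>y\<^bsub>(i,j)\<^esub>\<close> of \<open>(a\<^sub>0, \<dots>, a\<^bsub>n+1\<^esub>)\<close>; used for \<open>0 \<le> i \<le> n\<close> and \<open>1 \<le> j \<le> n\<close> only.\<close>

function nie_y :: "('x \<Rightarrow> 'x \<Rightarrow> 'x \<Rightarrow> 'x) \<Rightarrow> 'x list \<Rightarrow> nat \<Rightarrow> nat \<Rightarrow> 'x" where
  "nie_y v as i j =
     (if j < i then v (as ! (j - 1)) (as ! j) (nie_y v as i (j + 1))
      else if j > i + 1 then v (nie_y v as i (j - 1)) (as ! j) (as ! (j + 1))
      else v (as ! (j - 1)) (as ! j) (as ! (j + 1)))"
  by pat_completeness auto
termination
  by (relation "measure (\<lambda>(v, as, i, j). if j < i then i - j else j - i)") auto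

declare nie_y.simps [simp del]

text \<open>A basis element of degree \<open>n\<close> is a list of length \<open>n + 2\<close>, so \<open>n\<close> is \<open>length as - 2\<close>.\<close>

definition nie_boundary_basis ::
  "('x \<Rightarrow> 'x \<Rightarrow> 'x \<Rightarrow> 'x) \<Rightarrow> 'x list \<Rightarrow> ('x list \<Rightarrow>\<^sub>0 int)" where
  "nie_boundary_basis v as =
     (let n = length as - 2 in
      \<Sum>i = 0..n. frag_cmul ((- 1) ^ i)
        (frag_of (map (nie_y v as i) [1..<i + 1] @ drop (i + 1) as)
         - frag_of (take (i + 1) as @ map (nie_y v as i) [i + 1..<n + 1])))"

definition nie_boundary ::
  "('x \<Rightarrow> 'x \<Rightarrow> 'x \<Rightarrow> 'x) \<Rightarrow> int \<Rightarrow> ('x list \<Rightarrow>\<^sub>0 int) \<Rightarrow> ('x list \<Rightarrow>\<^sub>0 int)" where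
  "nie_boundary v n = (if n > 0 then frag_extend (nie_boundary_basis v) else (\<lambda>_. 0))"

definition nie_degenerate ::
  "'x set \<Rightarrow> ('x \<Rightarrow> 'x \<Rightarrow> 'x \<Rightarrow> 'x) \<Rightarrow> int \<Rightarrow> ('x list \<Rightarrow>\<^sub>0 int) set" where
  "nie_degenerate X v n =
     generate (nie_chain X n)
       (frag_of ` {as \<in> nie_basis X n.
          \<exists>j. 1 \<le> j \<and> int j \<le> n \<and> v (as ! (j - 1)) (as ! j) (as ! (j + 1)) = as ! j})"

abbreviation nie_groups ::
  "'x set \<Rightarrow> ('x \<Rightarrow> 'x \<Rightarrow> 'x \<Rightarrow> 'x) \<Rightarrow> int \<Rightarrow> ('x list \<Rightarrow>\<^sub>0 int) set monoid" where
  "nie_groups X v \<equiv> quotient_groups (nie_chain X) (nie_degenerate X v)"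

abbreviation nie_diff ::
  "'x set \<Rightarrow> ('x \<Rightarrow> 'x \<Rightarrow> 'x \<Rightarrow> 'x) \<Rightarrow> int \<Rightarrow> ('x list \<Rightarrow>\<^sub>0 int) set \<Rightarrow> ('x list \<Rightarrow>\<^sub>0 int) set" where
  "nie_diff X v \<equiv> quotient_boundary (nie_chain X) (nie_degenerate X v) (nie_boundary v)"

definition nie_homology where
  "nie_homology X v A n = homology_coeff (nie_groups X v) (nie_diff X v) A n"

definition nie_cohomology where
  "nie_cohomology X v A n = cohomology_coeff (nie_groups X v) (nie_diff X v) A n"

end

theory Submission
  imports Defs
begin

text \<open>
Both complexes have the same generators, seen as colourings of cubes. Colour the vertices of an
\<open>n\<close>-cube, i.e. the subsets \<open>S\<close> of \<open>{1, \<dots>, n}\<close>, by elements \<open>f S\<close> of \<open>X\<close> so that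
\<open>f (S \<union> {i, j}) = [f S, f (S \<union> {i}), f (S \<union> {j})]\<close> for \<open>i < j\<close> outside \<open>S\<close>. Axiom \<open>H2\<close> says that the
colour of the last vertex of a \<open>3\<close>-cube does not depend on the way in which it is computed. So a colouring is
freely determined by the colours \<open>a = f {}\<close> and \<open>b\<^sub>i = f {i}\<close> around the base vertex, which form the
generator \<open>((a, b\<^sub>1), \<dots>, (a, b\<^sub>n))\<close> of degree \<open>n\<close> of the local biquandle complex. As \<open>[a, b, _]\<close> is invertible, it
is also freely determined by the colours \<open>a\<^sub>k = f {1..k}\<close> along one path from the
base vertex to the opposite one, and \<open>(a\<^sub>0, \<dots>, a\<^sub>n)\<close> is a generator of degree \<open>n - 1\<close> of
Niebrzydowski's complex. The function \<open>cube_path\<close> passes from the first description to the second,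
and it is a bijection (\<open>bij_betw_bases\<close>).

Under this bijection the two boundaries are the same alternating sum over the facets of the
cube, with the same signs. In the local biquandle complex, removing \<open>(a, b\<^sub>i)\<close> restricts the colouring to the
facet of the sets without \<open>i\<close>, and the other term is the facet of the sets with \<open>i\<close>. In
Niebrzydowski's complex the elements \<open>y\<close> complete the initial or final part of the path to a path inside
one of these facets (\<open>cube_path_lower_facet\<close>, \<open>cube_path_upper_facet\<close>). Degenerate generators correspond too: by
injectivity of \<open>[a, b, _]\<close>, the equation \<open>b\<^sub>i = b\<^bsub>i+1\<^esub>\<close> at the base vertex holds iff its parallel copy at the
vertex \<open>{1, \<dots>, i-1}\<close> of the path does (\<open>degenerate_cube_path\<close>).

Hence the quotient complexes are isomorphic up to a shift of degree, and so are their homology and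
cohomology with any coefficients. The locale \<open>complex_iso\<close> carries an isomorphism of complexes through each
construction: quotients, tensor products, and groups of homomorphisms.
\<close>

section \<open>Isomorphisms of subquotients\<close>

lemma r_coset_eq_image: "M #>\<^bsub>G\<^esub> x = (\<lambda>m. m \<otimes>\<^bsub>G\<^esub> x) ` M"
  by (auto simp: r_coset_def)

lemma r_coset_subcarrier [simp]: "M #>\<^bsub>G\<lparr>carrier := S\<rparr>\<^esub> x = M #>\<^bsub>G\<^esub> x"
  by (simp add: r_coset_def)

lemma set_mult_subcarrier [simp]: "K <#>\<^bsub>G\<lparr>carrier := S\<rparr>\<^esub> L = K <#>\<^bsub>G\<^esub> L"
  by (simp add: set_mult_def)

lemma carrier_Mod: "carrier (G Mod M) = (\<lambda>x. M #>\<^bsub>G\<^esub> x) ` carrier G"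
  by (auto simp: FactGroup_def RCOSETS_def)

text \<open>The bijection is direct image: it sends the coset of \<open>x\<close> to the coset of \<open>f x\<close>, is injective because
\<open>f\<close> is, and takes products of sets to products of sets. The
carrier \<open>S\<close> is a separate parameter because a homology group is a quotient of a kernel by a subset
of the ambient group.\<close>

lemma image_iso_Mod:
  assumes "group G" "f \<in> iso G H" "S \<subseteq> carrier G" "M \<subseteq> carrier G"
  shows "(`) f \<in> iso (G\<lparr>carrier := S\<rparr> Mod M) (H\<lparr>carrier := f ` S\<rparr> Mod f ` M)"
proof -
  interpret group G by fact
  have f: "f \<in> hom G H" and inj: "inj_on f (carrier G)"
    using assms(2) by (auto simp: iso_def bij_betw_def)
  have coset: "M #>\<^bsub>G\<^esub> x \<subseteq> carrier G" if "x \<in> S" for x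
    using r_coset_subset_G[of M x] assms that by auto
  have img: "f ` (M #>\<^bsub>G\<^esub> x) = f ` M #>\<^bsub>H\<^esub> f x" if "x \<in> S" for x
    using coset_hom(2)[OF f] assms that by blast
  have "inj_on ((`) f) ((\<lambda>x. M #>\<^bsub>G\<^esub> x) ` S)"
    using coset by (auto simp: inj_on_def inj_on_image_eq_iff[OF inj])
  moreover have "(`) f ` (\<lambda>x. M #>\<^bsub>G\<^esub> x) ` S = (\<lambda>x. f ` M #>\<^bsub>H\<^esub> x) ` f ` S"
    using img by (simp add: image_image)
  moreover have "f ` (K <#>\<^bsub>G\<^esub> L) = f ` K <#>\<^bsub>H\<^esub> f ` L"
    if "K \<in> (\<lambda>x. M #>\<^bsub>G\<^esub> x) ` S" "L \<in> (\<lambda>x. M #>\<^bsub>G\<^esub> x) ` S" for K L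
    using that coset by (intro set_mult_hom[OF f]) auto
  ultimately show ?thesis
    unfolding iso_def hom_def bij_betw_def carrier_Mod
    by (auto simp: FactGroup_def img)
qed

text \<open>The common core of homology and cohomology: a commuting ladder between \<open>A \<rightarrow> B \<rightarrow> C\<close> and
\<open>A' \<rightarrow> B' \<rightarrow> C'\<close> carries the kernel of the second map to the kernel, by injectivity of \<open>\<gamma>\<close>,
and the image of the first map to the image, by surjectivity of \<open>\<alpha>\<close>.\<close>

lemma subquotient_iso:
  assumes "group B" "group C" "group B'" "group C'"
    and \<alpha>: "\<alpha> ` carrier A = carrier A'" and \<beta>: "\<beta> \<in> iso B B'" and \<gamma>: "\<gamma> \<in> iso C C'"
    and d: "d \<in> carrier A \<rightarrow> carrier B" and e: "e \<in> carrier B \<rightarrow> carrier C"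
    and d': "\<And>x. x \<in> carrier A \<Longrightarrow> \<beta> (d x) = d' (\<alpha> x)"
    and e': "\<And>x. x \<in> carrier B \<Longrightarrow> \<gamma> (e x) = e' (\<beta> x)"
  shows "B\<lparr>carrier := kernel B C e\<rparr> Mod d ` carrier A \<cong>
    B'\<lparr>carrier := kernel B' C' e'\<rparr> Mod d' ` carrier A'"
proof -
  have \<gamma>1: "\<gamma> \<one>\<^bsub>C\<^esub> = \<one>\<^bsub>C'\<^esub>"
    using \<gamma> assms hom_one by (auto simp: iso_def)
  have "e' (\<beta> x) = \<one>\<^bsub>C'\<^esub> \<longleftrightarrow> e x = \<one>\<^bsub>C\<^esub>" if "x \<in> carrier B" for x
  proof -
    have "e x \<in> carrier C" "\<one>\<^bsub>C\<^esub> \<in> carrier C"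
      using e that assms(2) by (auto simp: group.is_monoid)
    then show ?thesis
      using e'[OF that] \<gamma> \<gamma>1 by (metis (no_types, lifting) bij_betw_imp_inj_on inj_on_eq_iff iso_def mem_Collect_eq)
  qed
  moreover have "carrier B' = \<beta> ` carrier B"
    using \<beta> by (auto simp: iso_def bij_betw_def)
  ultimately have "\<beta> ` kernel B C e = kernel B' C' e'"
    by (auto simp: kernel_def)
  moreover have "\<beta> ` d ` carrier A = d' ` carrier A'"
    using d' by (force simp: \<alpha>[symmetric])
  moreover have "kernel B C e \<subseteq> carrier B" "d ` carrier A \<subseteq> carrier B"
    using d by (auto simp: kernel_def)
  ultimately show ?thesis
    using image_iso_Mod[OF \<open>group B\<close> \<beta>] by (metis is_isoI)
qed

section \<open>Isomorphisms of complexes\<close>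

locale complex_iso =
  fixes C :: "int \<Rightarrow> 'c monoid" and d :: "int \<Rightarrow> 'c \<Rightarrow> 'c"
    and C' :: "int \<Rightarrow> 'e monoid" and d' :: "int \<Rightarrow> 'e \<Rightarrow> 'e" and F :: "int \<Rightarrow> 'c \<Rightarrow> 'e"
  assumes comm: "comm_group (C n)" and comm': "comm_group (C' n)"
    and hom: "d n \<in> hom (C n) (C (n - 1))"
    and iso: "F n \<in> iso (C n) (C' n)"
    and commute: "x \<in> carrier (C n) \<Longrightarrow> F (n - 1) (d n x) = d' n (F n x)"
begin

lemma grp: "group (C n)" "group (C' n)"
  using comm comm' by (auto simp: comm_group_def)

lemma F_hom: "F n \<in> hom (C n) (C' n)"
  and F_inj: "inj_on (F n) (carrier (C n))"
  and F_image: "F n ` carrier (C n) = carrier (C' n)"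
  using iso[of n] by (auto simp: iso_def bij_betw_def)

lemma d_closed: "x \<in> carrier (C n) \<Longrightarrow> d n x \<in> carrier (C (n - 1))"
  using hom by (rule hom_in_carrier)

lemma F_closed: "x \<in> carrier (C n) \<Longrightarrow> F n x \<in> carrier (C' n)"
  using F_image by auto

lemma hom': "d' n \<in> hom (C' n) (C' (n - 1))"
  \<comment> \<open>Every element of \<open>C' n\<close> is written as \<open>F n x\<close>.\<close>
proof (rule homI; simp only: F_image[symmetric]; elim imageE; hypsubst)
  fix x assume x: "x \<in> carrier (C n)"
  then show "d' n (F n x) \<in> F (n - 1) ` carrier (C (n - 1))"
    by (metis commute d_closed imageI)
next
  fix x y assume x: "x \<in> carrier (C n)" and y: "y \<in> carrier (C n)"
  have "d' n (F n x \<otimes>\<^bsub>C' n\<^esub> F n y) = F (n - 1) (d n (x \<otimes>\<^bsub>C n\<^esub> y))"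
    using x y grp(1)[of n] by (simp add: commute hom_mult[OF F_hom] group.is_monoid monoid.m_closed)
  also have "\<dots> = d' n (F n x) \<otimes>\<^bsub>C' (n - 1)\<^esub> d' n (F n y)"
    using x y by (simp add: hom_mult[OF hom] hom_mult[OF F_hom] d_closed commute)
  finally show "d' n (F n x \<otimes>\<^bsub>C' n\<^esub> F n y) = d' n (F n x) \<otimes>\<^bsub>C' (n - 1)\<^esub> d' n (F n y)" .
qed

lemma inverse: "complex_iso C' d' C d (\<lambda>n. inv_into (carrier (C n)) (F n))"
proof (rule complex_iso.intro)
  fix n x assume "x \<in> carrier (C' n)"
  then obtain y where y: "y \<in> carrier (C n)" and x: "x = F n y"
    using F_image by blast
  have "d' n x = F (n - 1) (d n y)"
    using y by (simp add: x commute)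
  then show "inv_into (carrier (C (n - 1))) (F (n - 1)) (d' n x) = d n (inv_into (carrier (C n)) (F n) x)"
    using y by (simp add: x inv_into_f_f F_inj d_closed)
qed (simp_all add: comm comm' hom' group.iso_set_sym grp iso)

lemma homology_iso: "homology C d n \<cong> homology C' d' n"
  unfolding homology_def
proof (rule subquotient_iso[where A = "C (n + 1)" and B = "C n" and C = "C (n - 1)" and d = "d (n + 1)" and e = "d n"
      and A' = "C' (n + 1)" and B' = "C' n" and C' = "C' (n - 1)" and d' = "d' (n + 1)" and e' = "d' n"
      and \<alpha> = "F (n + 1)" and \<beta> = "F n" and \<gamma> = "F (n - 1)"])
  show "d (n + 1) \<in> carrier (C (n + 1)) \<rightarrow> carrier (C n)"
    using d_closed[of _ "n + 1"] by auto
  show "F n (d (n + 1) x) = d' (n + 1) (F (n + 1) x)" if "x \<in> carrier (C (n + 1))" for x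
    using commute[OF that] by simp
qed (use grp F_image iso commute d_closed in auto)

end

text \<open>The defining formula takes the unique element of a set of cosets; that this set is a singleton is
exactly what \<open>f ` M \<subseteq> N\<close> guarantees.\<close>

lemma (in comm_group) r_coset_induced_map:
  assumes "group H" "f \<in> hom G H" "subgroup M G" "subgroup N H" "f ` M \<subseteq> N" "x \<in> carrier G"
  shows "induced_map H N f (M #> x) = N #>\<^bsub>H\<^esub> f x"
proof -
  interpret H: group H by fact
  interpret M: subgroup M G by fact
  have "N #>\<^bsub>H\<^esub> f (m \<otimes> x) = N #>\<^bsub>H\<^esub> f x" if "m \<in> M" for m
  proof -
    have *: "f m \<in> N" "f m \<in> carrier H" "f x \<in> carrier H" "m \<in> carrier G"
      using assms that by (auto intro: hom_in_carrier)
    then have "N #>\<^bsub>H\<^esub> f (m \<otimes> x) = (N #>\<^bsub>H\<^esub> f m) #>\<^bsub>H\<^esub> f x"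
      using assms by (simp add: hom_mult[of f G H] H.coset_mult_assoc subgroup.subset)
    then show ?thesis
      using H.coset_join2[OF _ assms(4)] * by simp
  qed
  then have "(\<lambda>m. N #>\<^bsub>H\<^esub> f (m \<otimes> x)) ` M = (\<lambda>m. N #>\<^bsub>H\<^esub> f x) ` M"
    by (rule image_cong[OF refl])
  then have "(\<lambda>y. N #>\<^bsub>H\<^esub> f y) ` (M #> x) = {N #>\<^bsub>H\<^esub> f x}"
    using M.one_closed by (simp add: r_coset_eq_image[of G] image_image image_constant)
  then show ?thesis
    by (simp add: induced_map_def)
qed

text \<open>This serves twice: for the quotient by degenerate chains, and for tensor products, which are
quotients of free groups by the bilinearity relations. That \<open>d'\<close> respects \<open>D'\<close> is transported
along \<open>F\<close> from the same property of \<open>d\<close>, so it has to be verified in one of the two complexes only.\<close>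

lemma (in complex_iso) quotient_complex_iso:
  assumes sub: "\<And>n. subgroup (D n) (C n)" and dD: "\<And>n. d n ` D n \<subseteq> D (n - 1)"
    and D': "\<And>n. F n ` D n = D' n"
  shows "complex_iso (quotient_groups C D) (quotient_boundary C D d)
    (quotient_groups C' D') (quotient_boundary C' D' d') (\<lambda>n. (`) (F n))"
proof (rule complex_iso.intro)
  fix n
  interpret Cn: comm_group "C n" by (rule comm)
  interpret Cn1: comm_group "C (n - 1)" by (rule comm)
  interpret C'n: comm_group "C' n" by (rule comm')
  interpret N: normal "D n" "C n"
    by (rule Cn.subgroup_imp_normal[OF sub])
  interpret N1: normal "D (n - 1)" "C (n - 1)"
    by (rule Cn1.subgroup_imp_normal[OF sub])
  have sub': "subgroup (D' m) (C' m)" for m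
    unfolding D'[symmetric] using grp F_hom
    by (intro group_hom.subgroup_img_is_subgroup[OF _ sub]) (simp add: group_hom_def group_hom_axioms_def)
  show "comm_group (quotient_groups C D n)"
    by (simp add: quotient_groups_def Cn.abelian_FactGroup sub)
  show "comm_group (quotient_groups C' D' n)"
    by (simp add: quotient_groups_def C'n.abelian_FactGroup sub')
  have ind: "quotient_boundary C D d n (D n #>\<^bsub>C n\<^esub> x) = D (n - 1) #>\<^bsub>C (n - 1)\<^esub> d n x"
    if "x \<in> carrier (C n)" for x
    unfolding quotient_boundary_def using that
    by (intro Cn.r_coset_induced_map grp hom sub dD)
  have dD': "d' n ` D' n \<subseteq> D' (n - 1)"
  proof -
    have "d' n (F n x) \<in> F (n - 1) ` D (n - 1)" if "x \<in> D n" for x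
      using that dD[of n] commute[of x n] by (force simp: N.subset[THEN subsetD])
    then show ?thesis
      unfolding D'[symmetric] by blast
  qed
  have ind': "quotient_boundary C' D' d' n (D' n #>\<^bsub>C' n\<^esub> x) = D' (n - 1) #>\<^bsub>C' (n - 1)\<^esub> d' n x"
    if "x \<in> carrier (C' n)" for x
    unfolding quotient_boundary_def using that
    by (intro C'n.r_coset_induced_map grp hom' sub' dD')
  have carr: "carrier (quotient_groups C D m) = (\<lambda>x. D m #>\<^bsub>C m\<^esub> x) ` carrier (C m)" for m
    by (simp add: quotient_groups_def carrier_Mod)
  show "quotient_boundary C D d n \<in> hom (quotient_groups C D n) (quotient_groups C D (n - 1))"
  proof (rule homI; simp only: carr; elim imageE; hypsubst)
    fix x y assume "x \<in> carrier (C n)" "y \<in> carrier (C n)"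
    then show "quotient_boundary C D d n ((D n #>\<^bsub>C n\<^esub> x) \<otimes>\<^bsub>quotient_groups C D n\<^esub> (D n #>\<^bsub>C n\<^esub> y)) =
      quotient_boundary C D d n (D n #>\<^bsub>C n\<^esub> x) \<otimes>\<^bsub>quotient_groups C D (n - 1)\<^esub> quotient_boundary C D d n (D n #>\<^bsub>C n\<^esub> y)"
      by (simp add: ind d_closed quotient_groups_def FactGroup_def N.rcos_sum N1.rcos_sum hom_mult[OF hom])
  qed (simp add: ind d_closed)
  have "carrier (C' n) = F n ` carrier (C n)"
    by (simp add: F_image)
  then show "(`) (F n) \<in> iso (quotient_groups C D n) (quotient_groups C' D' n)"
    using image_iso_Mod[OF grp(1) iso[of n] order_refl N.subset]
    by (simp add: D' quotient_groups_def F_image)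
  fix K assume "K \<in> carrier (quotient_groups C D n)"
  then obtain x where x: "x \<in> carrier (C n)" and K: "K = D n #>\<^bsub>C n\<^esub> x"
    using carr by blast
  show "F (n - 1) ` quotient_boundary C D d n K = quotient_boundary C' D' d' n (F n ` K)"
    using x by (simp add: K ind ind' coset_hom(2)[OF F_hom] N.subset N1.subset D' F_closed d_closed commute)
qed

lemma frag_extend_hom:
  assumes "\<And>x. x \<in> S \<Longrightarrow> Poly_Mapping.keys (g x) \<subseteq> T"
  shows "frag_extend g \<in> hom (free_Abelian_group S) (free_Abelian_group T)"
proof (rule homI)
  fix x assume "x \<in> carrier (free_Abelian_group S)"
  then show "frag_extend g x \<in> carrier (free_Abelian_group T)"
    using assms keys_frag_extend[of g x] by (fastforce simp: subset_iff)
qed (simp add: frag_extend_add)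

lemma frag_extend_frag_extend:
  "frag_extend f (frag_extend g x) = frag_extend (\<lambda>y. frag_extend f (g y)) x"
  using subset_UNIV by (induction x rule: frag_induction) (simp_all add: frag_extend_diff)

lemma frag_extend_iso:
  assumes "bij_betw \<phi> S T"
  shows "frag_extend (frag_of \<circ> \<phi>) \<in> iso (free_Abelian_group S) (free_Abelian_group T)"
proof -
  have "frag_extend (frag_of \<circ> inv_into S \<phi>) (frag_extend (frag_of \<circ> \<phi>) x) = x"
    if "Poly_Mapping.keys x \<subseteq> S" for x
  proof -
    have "frag_extend (frag_of \<circ> inv_into S \<phi>) (frag_extend (frag_of \<circ> \<phi>) x) = frag_extend frag_of x"
      unfolding frag_extend_frag_extend
      using that bij_betw_imp_inj_on[OF assms] by (intro frag_extend_eq) (auto simp: inv_into_f_f)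
    then show ?thesis by (simp flip: frag_expansion)
  qed
  moreover have "frag_extend (frag_of \<circ> \<phi>) (frag_extend (frag_of \<circ> inv_into S \<phi>) x) = x"
    if "Poly_Mapping.keys x \<subseteq> T" for x
  proof -
    have "frag_extend (frag_of \<circ> \<phi>) (frag_extend (frag_of \<circ> inv_into S \<phi>) x) = frag_extend frag_of x"
      unfolding frag_extend_frag_extend
      using that bij_betw_imp_surj_on[OF assms] by (intro frag_extend_eq) (auto simp: f_inv_into_f subset_iff)
    then show ?thesis by (simp flip: frag_expansion)
  qed
  moreover have "frag_extend (frag_of \<circ> \<phi>) \<in> hom (free_Abelian_group S) (free_Abelian_group T)"
    using assms by (intro frag_extend_hom) (auto simp: bij_betw_def)
  moreover have "frag_extend (frag_of \<circ> inv_into S \<phi>) \<in> hom (free_Abelian_group T) (free_Abelian_group S)"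
    using bij_betw_inv_into[OF assms] by (intro frag_extend_hom) (auto simp: bij_betw_def)
  ultimately have "group_isomorphisms (free_Abelian_group S) (free_Abelian_group T)
      (frag_extend (frag_of \<circ> \<phi>)) (frag_extend (frag_of \<circ> inv_into S \<phi>))"
    by (simp add: group_isomorphisms_def)
  then show ?thesis
    by (rule group_isomorphisms_imp_iso)
qed

text \<open>A bijection of bases that matches the boundaries of basis elements is all that has to be exhibited.\<close>

lemma free_complex_iso:
  assumes bij: "\<And>n. bij_betw (\<phi> n) (S n) (T n)"
    and keys: "\<And>n x. x \<in> S n \<Longrightarrow> Poly_Mapping.keys (g n x) \<subseteq> S (n - 1)"
    and comm: "\<And>n x. x \<in> S n \<Longrightarrow> frag_extend (frag_of \<circ> \<phi> (n - 1)) (g n x) = g' n (\<phi> n x)"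
  shows "complex_iso (\<lambda>n. free_Abelian_group (S n)) (\<lambda>n. frag_extend (g n))
    (\<lambda>n. free_Abelian_group (T n)) (\<lambda>n. frag_extend (g' n)) (\<lambda>n. frag_extend (frag_of \<circ> \<phi> n))"
proof (rule complex_iso.intro)
  fix n x assume "x \<in> carrier (free_Abelian_group (S n))"
  then show "frag_extend (frag_of \<circ> \<phi> (n - 1)) (frag_extend (g n) x) =
      frag_extend (g' n) (frag_extend (frag_of \<circ> \<phi> n) x)"
    unfolding frag_extend_frag_extend by (intro frag_extend_eq) (auto simp: comm)
qed (simp_all add: abelian_free_Abelian_group frag_extend_hom frag_extend_iso bij keys)

lemma image_generate:
  assumes "group G" "group H" "f \<in> hom G H" "S \<subseteq> carrier G"
  shows "f ` generate G S = generate H (f ` S)"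
  using assms group_hom.generate_img[of G H f S] by (simp add: group_hom_def group_hom_axioms_def)

section \<open>Coefficients: tensor products\<close>

text \<open>The relations are separated from the subgroup that they generate so that homomorphisms can be
checked on them one by one.\<close>

definition tensor_generators ::
  "('g, 'm) monoid_scheme \<Rightarrow> ('a, 'k) monoid_scheme \<Rightarrow> ('g \<times> 'a \<Rightarrow>\<^sub>0 int) set" where
  "tensor_generators G A =
     {frag_of (x \<otimes>\<^bsub>G\<^esub> y, a) - (frag_of (x, a) + frag_of (y, a)) | x y a.
        x \<in> carrier G \<and> y \<in> carrier G \<and> a \<in> carrier A}
     \<union> {frag_of (x, a \<otimes>\<^bsub>A\<^esub> b) - (frag_of (x, a) + frag_of (x, b)) | x a b.
        x \<in> carrier G \<and> a \<in> carrier A \<and> b \<in> carrier A}"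

abbreviation pair_map :: "('g \<Rightarrow> 'h) \<Rightarrow> ('g \<times> 'a \<Rightarrow>\<^sub>0 int) \<Rightarrow> ('h \<times> 'a \<Rightarrow>\<^sub>0 int)" where
  "pair_map f \<equiv> frag_extend (\<lambda>(x, a). frag_of (f x, a))"

lemma pair_map_eq: "pair_map f = frag_extend (frag_of \<circ> (\<lambda>(x, a). (f x, a)))"
proof -
  have "(\<lambda>(x, a). frag_of (f x, a)) = frag_of \<circ> (\<lambda>(x, a). (f x, a))"
    by (rule ext) (simp add: case_prod_unfold)
  then show ?thesis
    by (rule arg_cong)
qed

lemma tensor_relations_generate:
  "tensor_relations G A = generate (free_Abelian_group (carrier G \<times> carrier A)) (tensor_generators G A)"
  by (simp add: tensor_relations_def tensor_generators_def)

lemma tensor_generators_carrier: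
  assumes "group G" "group A"
  shows "tensor_generators G A \<subseteq> carrier (free_Abelian_group (carrier G \<times> carrier A))"
proof -
  interpret G: group G by fact
  interpret A: group A by fact
  have keys3: "Poly_Mapping.keys (frag_of p - (frag_of q + frag_of r)) \<subseteq> {p, q, r}" for p q r :: "'z"
    using keys_diff[of "frag_of p" "frag_of q + frag_of r"] keys_add[of "frag_of q" "frag_of r"] by auto
  show ?thesis
    unfolding tensor_generators_def
    by (intro subsetI; elim UnE CollectE exE; simp only: carrier_free_Abelian_group_iff; intro order_trans[OF keys3]; simp)
qed

lemma pair_map_tensor_generators:
  assumes "f \<in> hom G H"
  shows "pair_map f ` tensor_generators G A \<subseteq> tensor_generators H A"
proof (rule image_subsetI)
  fix u assume "u \<in> tensor_generators G A"
  then consider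
    x y a where "u = frag_of (x \<otimes>\<^bsub>G\<^esub> y, a) - (frag_of (x, a) + frag_of (y, a))"
      "x \<in> carrier G" "y \<in> carrier G" "a \<in> carrier A"
  | x a b where "u = frag_of (x, a \<otimes>\<^bsub>A\<^esub> b) - (frag_of (x, a) + frag_of (x, b))"
      "x \<in> carrier G" "a \<in> carrier A" "b \<in> carrier A"
    unfolding tensor_generators_def by blast
  then show "pair_map f u \<in> tensor_generators H A"
  proof cases
    case 1
    then have "pair_map f u = frag_of (f x \<otimes>\<^bsub>H\<^esub> f y, a) - (frag_of (f x, a) + frag_of (f y, a))"
      by (simp add: frag_extend_diff frag_extend_add hom_mult[OF assms])
    then show ?thesis
      using 1 hom_in_carrier[OF assms] unfolding tensor_generators_def by blast
  next
    case 2
    then have "pair_map f u = frag_of (f x, a \<otimes>\<^bsub>A\<^esub> b) - (frag_of (f x, a) + frag_of (f x, b))"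
      by (simp add: frag_extend_diff frag_extend_add)
    then show ?thesis
      using 2 hom_in_carrier[OF assms] unfolding tensor_generators_def by blast
  qed
qed

text \<open>The inverse of \<open>f\<close> maps relations back to relations, by the preceding lemma, and undoes \<open>pair_map f\<close>.\<close>

lemma pair_map_tensor_generators_iso:
  assumes G: "group G" and H: "group H" and A: "group A" and f: "f \<in> iso G H"
  shows "pair_map f ` tensor_generators G A = tensor_generators H A"
proof
  interpret group G by fact
  have hom: "f \<in> hom G H" and g: "inv_into (carrier G) f \<in> hom H G"
    and bij: "bij_betw f (carrier G) (carrier H)"
    using f iso_set_sym[OF f] by (auto simp: iso_def)
  show "pair_map f ` tensor_generators G A \<subseteq> tensor_generators H A"
    by (rule pair_map_tensor_generators[OF hom])
  have "pair_map f (pair_map (inv_into (carrier G) f) u) = u" if "u \<in> tensor_generators H A" for u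
  proof -
    have "Poly_Mapping.keys u \<subseteq> carrier H \<times> carrier A"
      using subsetD[OF tensor_generators_carrier[OF H A] that] by simp
    then have "pair_map f (pair_map (inv_into (carrier G) f) u) = frag_extend frag_of u"
      unfolding frag_extend_frag_extend using bij
      by (intro frag_extend_eq) (auto simp: bij_betw_def f_inv_into_f)
    then show ?thesis
      by (simp flip: frag_expansion)
  qed
  then show "tensor_generators H A \<subseteq> pair_map f ` tensor_generators G A"
    using pair_map_tensor_generators[OF g, of A] by force
qed

lemma (in complex_iso) tensor_complex_iso:
  assumes "group A"
  shows "complex_iso (\<lambda>n. tensor_group (C n) A) (\<lambda>n. tensor_map (C (n - 1)) A (d n))
    (\<lambda>n. tensor_group (C' n) A) (\<lambda>n. tensor_map (C' (n - 1)) A (d' n)) (\<lambda>n. (`) (pair_map (F n)))"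
proof -
  let ?T = "\<lambda>C n. free_Abelian_group (carrier (C n) \<times> carrier A)"
  let ?R = "\<lambda>C n. tensor_relations (C n) A"
  have F_eq: "(\<lambda>n. pair_map (F n)) = (\<lambda>n. frag_extend (frag_of \<circ> (\<lambda>(x, a). (F n x, a))))"
    by (rule ext, rule pair_map_eq)
  have "complex_iso (?T C) (\<lambda>n. pair_map (d n)) (?T C') (\<lambda>n. pair_map (d' n)) (\<lambda>n. pair_map (F n))"
    unfolding F_eq
  proof (rule free_complex_iso[where S = "\<lambda>n. carrier (C n) \<times> carrier A" and T = "\<lambda>n. carrier (C' n) \<times> carrier A"
      and g = "\<lambda>n (x, a). frag_of (d n x, a)" and g' = "\<lambda>n (x, a). frag_of (d' n x, a)"
      and \<phi> = "\<lambda>n (x, a). (F n x, a)"])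
    show "bij_betw (\<lambda>(x, a). (F n x, a)) (carrier (C n) \<times> carrier A) (carrier (C' n) \<times> carrier A)" for n
      using bij_betw_map_prod[of "F n" "carrier (C n)" "carrier (C' n)" id "carrier A" "carrier A"] iso[of n]
      by (simp add: iso_def map_prod_def)
    show "Poly_Mapping.keys (case x of (x, a) \<Rightarrow> frag_of (d n x, a)) \<subseteq> carrier (C (n - 1)) \<times> carrier A"
      if "x \<in> carrier (C n) \<times> carrier A" for n x
      using that by (auto simp: d_closed)
  qed (auto simp: commute)
  then interpret T: complex_iso "?T C" "\<lambda>n. pair_map (d n)" "?T C'" "\<lambda>n. pair_map (d' n)" "\<lambda>n. pair_map (F n)" .
  have gens: "tensor_generators (C n) A \<subseteq> carrier (?T C n)" for n
    using tensor_generators_carrier[OF grp(1) assms] .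
  have "complex_iso (quotient_groups (?T C) (?R C)) (quotient_boundary (?T C) (?R C) (\<lambda>n. pair_map (d n)))
      (quotient_groups (?T C') (?R C')) (quotient_boundary (?T C') (?R C') (\<lambda>n. pair_map (d' n)))
      (\<lambda>n. (`) (pair_map (F n)))"
  proof (rule T.quotient_complex_iso[where D = "?R C" and D' = "?R C'"])
    fix n
    show "subgroup (?R C n) (?T C n)"
      using gens by (simp add: tensor_relations_generate group.generate_is_subgroup)
    show "pair_map (F n) ` ?R C n = ?R C' n"
      unfolding tensor_relations_generate image_generate[OF T.grp T.F_hom gens]
      by (simp only: pair_map_tensor_generators_iso[OF grp(1) grp(2) assms iso])
    show "pair_map (d n) ` ?R C n \<subseteq> ?R C (n - 1)"
      unfolding tensor_relations_generate image_generate[OF T.grp(1) T.grp(1) T.hom gens]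
      by (intro group.mono_generate T.grp pair_map_tensor_generators hom)
  qed
  then show ?thesis
    by (simp add: quotient_groups_def[abs_def] quotient_boundary_def[abs_def] tensor_group_def tensor_map_def)
qed

lemma (in complex_iso) homology_coeff_iso:
  assumes "group A"
  shows "homology_coeff C d A n \<cong> homology_coeff C' d' A n"
  unfolding homology_coeff_def
  by (rule complex_iso.homology_iso[OF tensor_complex_iso[OF assms]])

section \<open>Coefficients: groups of homomorphisms\<close>

lemma group_hom_group:
  assumes "group G" "comm_group A"
  shows "group (hom_group G A)"
proof -
  interpret G: group G by fact
  interpret A: comm_group A by fact
  note hom_group_simps = hom_group_def hom_def Pi_iff
  show ?thesis
  proof (rule groupI)
    fix f assume f: "f \<in> carrier (hom_group G A)"
    then have "(\<lambda>x\<in>carrier G. inv\<^bsub>A\<^esub> f x) \<in> carrier (hom_group G A)"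
      by (auto simp: hom_group_simps A.inv_mult)
    moreover have "(\<lambda>x\<in>carrier G. inv\<^bsub>A\<^esub> f x) \<otimes>\<^bsub>hom_group G A\<^esub> f = \<one>\<^bsub>hom_group G A\<^esub>"
      using f by (auto simp: hom_group_simps intro!: restrict_ext)
    ultimately show "\<exists>g\<in>carrier (hom_group G A). g \<otimes>\<^bsub>hom_group G A\<^esub> f = \<one>\<^bsub>hom_group G A\<^esub>"
      by blast
  next
    fix f assume "f \<in> carrier (hom_group G A)"
    then show "\<one>\<^bsub>hom_group G A\<^esub> \<otimes>\<^bsub>hom_group G A\<^esub> f = f"
      by (auto simp: hom_group_simps intro!: extensionalityI[of _ "carrier G"])
  qed (auto simp: hom_group_simps A.m_assoc A.m_ac intro!: restrict_ext)
qed

definition precompose :: "('g, 'm) monoid_scheme \<Rightarrow> ('g \<Rightarrow> 'h) \<Rightarrow> ('h \<Rightarrow> 'a) \<Rightarrow> 'g \<Rightarrow> 'a" where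
  "precompose G u f = (\<lambda>x\<in>carrier G. f (u x))"

lemma precompose_closed:
  assumes "group G" "u \<in> hom G H" "f \<in> carrier (hom_group H A)"
  shows "precompose G u f \<in> carrier (hom_group G A)"
proof -
  interpret group G by fact
  show ?thesis
    using assms(2,3) by (auto simp: precompose_def hom_group_def hom_def Pi_iff)
qed

lemma precompose_hom:
  assumes "group G" "u \<in> hom G H"
  shows "precompose G u \<in> hom (hom_group H A) (hom_group G A)"
proof (rule homI)
  fix f g assume "f \<in> carrier (hom_group H A)" "g \<in> carrier (hom_group H A)"
  show "precompose G u (f \<otimes>\<^bsub>hom_group H A\<^esub> g) =
      precompose G u f \<otimes>\<^bsub>hom_group G A\<^esub> precompose G u g"
    using hom_in_carrier[OF assms(2)]
    by (auto simp: precompose_def hom_group_def intro!: restrict_ext)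
qed (rule precompose_closed[OF assms])

lemma precompose_precompose:
  assumes "v \<in> carrier G \<rightarrow> carrier H"
  shows "precompose G v (precompose H u f) = (\<lambda>x\<in>carrier G. f (u (v x)))"
  using assms by (auto simp: precompose_def intro!: restrict_ext)

text \<open>Precomposition reverses arrows, so its inverse is precomposition with \<open>inv_into (carrier G) u\<close>;
the composites are the identity because the elements of \<open>hom_group\<close> are extensional.\<close>

lemma precompose_iso:
  assumes "group G" "group H" "u \<in> iso G H"
  shows "precompose G u \<in> iso (hom_group H A) (hom_group G A)"
proof -
  let ?v = "inv_into (carrier G) u"
  have hom: "u \<in> hom G H" "?v \<in> hom H G" and bij: "bij_betw u (carrier G) (carrier H)"
    using assms group.iso_set_sym by (auto simp: iso_def)
  have "precompose H ?v (precompose G u f) = f" if "f \<in> carrier (hom_group H A)" for f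
    using that hom bij
    by (auto simp: precompose_precompose hom_def hom_group_def bij_betw_def f_inv_into_f
        intro!: extensionalityI[of _ "carrier H"])
  moreover have "precompose G u (precompose H ?v f) = f" if "f \<in> carrier (hom_group G A)" for f
    using that hom bij
    by (auto simp: precompose_precompose hom_def hom_group_def bij_betw_def inv_into_f_f
        intro!: extensionalityI[of _ "carrier G"])
  ultimately have "group_isomorphisms (hom_group H A) (hom_group G A) (precompose G u) (precompose H ?v)"
    using precompose_hom[OF assms(1) hom(1), of A] precompose_hom[OF assms(2) hom(2), of A]
    by (simp add: group_isomorphisms_def)
  then show ?thesis
    by (rule group_isomorphisms_imp_iso)
qed

lemma cohomology_coeff_precompose:
  "cohomology_coeff C d A =
    cohomology (\<lambda>n. hom_group (C n) A) (\<lambda>n. precompose (C (n + 1)) (d (n + 1)))"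
  by (simp add: cohomology_coeff_def precompose_def[abs_def])

text \<open>Contravariance puts the primed complex on the left. The ladder has the cochain groups in degrees
\<open>n - 1\<close>, \<open>n\<close>, \<open>n + 1\<close> as columns.\<close>

lemma (in complex_iso) cohomology_coeff_iso:
  assumes "comm_group A"
  shows "cohomology_coeff C' d' A n \<cong> cohomology_coeff C d A n"
proof -
  have iso': "precompose (C m) (F m) \<in> iso (hom_group (C' m) A) (hom_group (C m) A)" for m
    by (rule precompose_iso[OF grp iso])
  have coboundary: "precompose (C' m) (d' m) f \<in> carrier (hom_group (C' m) A)"
    if "f \<in> carrier (hom_group (C' (m - 1)) A)" for m f
    using that by (rule precompose_closed[OF grp(2) hom'])
  have natural: "precompose (C m) (F m) (precompose (C' m) (d' m) f) =
      precompose (C m) (d m) (precompose (C (m - 1)) (F (m - 1)) f)" for m f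
    by (subst precompose_precompose; (subst precompose_precompose)?)
       (auto simp: F_closed d_closed commute intro!: restrict_ext)
  show ?thesis
    unfolding cohomology_coeff_precompose cohomology_def
  proof (rule subquotient_iso[where \<alpha> = "precompose (C (n - 1)) (F (n - 1))"
        and \<beta> = "precompose (C n) (F n)" and \<gamma> = "precompose (C (n + 1)) (F (n + 1))"])
    show "precompose (C (n - 1)) (F (n - 1)) ` carrier (hom_group (C' (n - 1)) A) = carrier (hom_group (C (n - 1)) A)"
      using iso'[of "n - 1"] by (simp add: iso_def bij_betw_def)
  qed (use iso' coboundary[of _ n] coboundary[of _ "n + 1"] natural[of n] natural[of "n + 1"] in
      \<open>auto simp: group_hom_group grp assms\<close>)
qed

section \<open>Colourings of a cube\<close>

text \<open>The list \<open>bs = [b\<^sub>1, \<dots>, b\<^sub>n]\<close> stands for the colouring \<open>f\<close> of the vertices of an \<open>n\<close>-cube, that is of the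
subsets of \<open>{1, \<dots>, n}\<close>, with \<open>f {} = a\<close>, \<open>f {i} = b\<^sub>i\<close> and
\<open>f (S \<union> {i, j}) = br (f S) (f (S \<union> {i})) (f (S \<union> {j}))\<close> for \<open>i < j\<close> outside \<open>S\<close>. The path lists
\<open>f {}, f {1}, f {1, 2}, \<dots>\<close>. The recursion steps to the facet of the subsets containing \<open>1\<close>, where the base
colour is \<open>b\<^sub>1\<close> and the neighbours of the base vertex have the colours \<open>f {1, j} = br a b\<^sub>1 b\<^sub>j\<close>.\<close>

fun cube_path :: "('x \<Rightarrow> 'x \<Rightarrow> 'x \<Rightarrow> 'x) \<Rightarrow> 'x \<Rightarrow> 'x list \<Rightarrow> 'x list" where
  "cube_path br a [] = [a]"
| "cube_path br a (b # bs) = a # cube_path br b (map (br a b) bs)"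

lemma length_cube_path [simp]: "length (cube_path br a bs) = Suc (length bs)"
  by (induction br a bs rule: cube_path.induct) auto

lemma hd_cube_path [simp]: "hd (cube_path br a bs) = a"
  and cube_path_nth_0 [simp]: "cube_path br a bs ! 0 = a"
  and cube_path_ne [simp]: "cube_path br a bs \<noteq> []"
  by (cases bs; simp)+

text \<open>The recursion for \<open>nie_y\<close> compares its two indices and reads entries around \<open>j\<close>, so dropping the first
vertex of a path shifts both indices. This turns statements about facets into inductions along the path.\<close>

lemma nie_y_Cons:
  "1 \<le> j \<Longrightarrow> nie_y v (a # as) (Suc i) (Suc j) = nie_y v as i j"
proof (induction v as i j rule: nie_y.induct)
  case (1 v as i j)
  then show ?case
    by (subst (1 2) nie_y.simps) (auto simp: nth_Cons')
qed

context horizontal_tribracket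
begin

abbreviation vert where "vert \<equiv> vertical_tribracket X br"

lemma br_inj: "\<lbrakk>a \<in> X; b \<in> X; c \<in> X; d \<in> X\<rbrakk> \<Longrightarrow> br a b c = br a b d \<longleftrightarrow> c = d"
  using H1_right[of a b "br a b c"] closed by metis

lemma vert_br: "\<lbrakk>a \<in> X; b \<in> X; c \<in> X\<rbrakk> \<Longrightarrow> vert a b (br a b c) = c"
  unfolding vertical_tribracket_def by (rule the_equality) (auto simp: br_inj)

lemma br_vert: "\<lbrakk>a \<in> X; b \<in> X; c \<in> X\<rbrakk> \<Longrightarrow> vert a b c \<in> X \<and> br a b (vert a b c) = c"
  unfolding vertical_tribracket_def by (rule theI') (rule H1_right)

text \<open>The two equalities say that the colour of the vertex opposite to the base vertex of a \<open>3\<close>-cube is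
the same when it is computed from the square at any of the three neighbours.\<close>

lemma H2_left: "\<lbrakk>a \<in> X; b \<in> X; c \<in> X; d \<in> X\<rbrakk> \<Longrightarrow> br b (br a b c) (br a b d) = br c (br a b c) (br a c d)"
  and H2_right: "\<lbrakk>a \<in> X; b \<in> X; c \<in> X; d \<in> X\<rbrakk> \<Longrightarrow> br b (br a b c) (br a b d) = br d (br a b d) (br a c d)"
  using H2[of a b c d] by auto

lemma closed_map: "\<lbrakk>a \<in> X; b \<in> X; set bs \<subseteq> X\<rbrakk> \<Longrightarrow> set (map (br a b) bs) \<subseteq> X"
  using closed by auto

lemma set_cube_path: "\<lbrakk>a \<in> X; set bs \<subseteq> X\<rbrakk> \<Longrightarrow> set (cube_path br a bs) \<subseteq> X"
proof (induction "length bs" arbitrary: a bs)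
  case (Suc k)
  then show ?case
    by (cases bs) (use closed_map in auto)
qed auto

text \<open>In the colouring with neighbours \<open>b # bs\<close>, the two paths run through the vertices \<open>f {2..j+1}\<close> and
\<open>f {1..j+1}\<close>, along opposite facets. Each quadrilateral between them satisfies the tribracket relation; when
the path advances, the colours of the next facet are again of the form \<open>map (br _ _)\<close> because the two
ways round a \<open>3\<close>-cube agree.\<close>

lemma cube_path_opposite:
  assumes "a \<in> X" "b \<in> X" "set bs \<subseteq> X" "j < length bs"
  shows "br (cube_path br a bs ! j) (cube_path br b (map (br a b) bs) ! j) (cube_path br a bs ! Suc j) =
    cube_path br b (map (br a b) bs) ! Suc j"
  using assms
proof (induction j arbitrary: a b bs)
  case 0
  then show ?case by (cases bs) auto
next
  case (Suc j)
  then obtain c cs where bs: "bs = c # cs" by (cases bs) auto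
  have swap: "map (br b (br a b c)) (map (br a b) cs) = map (br c (br a b c)) (map (br a c) cs)"
    using Suc.prems by (auto simp: bs subset_iff intro!: H2_left)
  have "br (cube_path br c (map (br a c) cs) ! j)
      (cube_path br (br a b c) (map (br c (br a b c)) (map (br a c) cs)) ! j)
      (cube_path br c (map (br a c) cs) ! Suc j) =
    cube_path br (br a b c) (map (br c (br a b c)) (map (br a c) cs)) ! Suc j"
    using Suc.prems by (intro Suc.IH closed closed_map) (auto simp: bs)
  then show ?case
    by (simp add: bs flip: swap del: map_map)
qed

text \<open>With index \<open>0\<close> the recursion for \<open>nie_y\<close> solves, one quadrilateral at a time, for the vertices of the path that avoids
the first direction, starting from the path that takes it first.\<close>

lemma nie_y_0_cube_path:
  assumes "a \<in> X" "b \<in> X" "set bs \<subseteq> X" "j < length bs"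
  shows "nie_y vert (cube_path br a (b # bs)) 0 (Suc j) = cube_path br a bs ! Suc j"
  using assms(4)
proof (induction j)
  case 0
  then obtain c cs where bs: "bs = c # cs" by (cases bs) auto
  show ?case
    by (subst nie_y.simps) (use assms in \<open>auto simp: bs vert_br\<close>)
next
  case (Suc j)
  let ?z = "cube_path br a bs" and ?y = "cube_path br b (map (br a b) bs)"
  have X: "set ?z \<subseteq> X" "set ?y \<subseteq> X"
    by (intro set_cube_path closed_map assms)+
  have "nie_y vert (cube_path br a (b # bs)) 0 (Suc (Suc j)) = vert (?z ! Suc j) (?y ! Suc j) (?y ! Suc (Suc j))"
    by (subst nie_y.simps) (use Suc in auto)
  also have "?y ! Suc (Suc j) = br (?z ! Suc j) (?y ! Suc j) (?z ! Suc (Suc j))"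
    using cube_path_opposite[OF assms(1-3) Suc.prems] by simp
  also have "vert (?z ! Suc j) (?y ! Suc j) \<dots> = ?z ! Suc (Suc j)"
    using X Suc.prems by (intro vert_br) (auto simp: subset_iff)
  finally show ?case .
qed

text \<open>Both sides are the path of the facet of the subsets not containing direction \<open>i + 1\<close>: its vertices agree with those of the
cube up to index \<open>i\<close>, and from there on they are the completions \<open>nie_y\<close>.\<close>

lemma cube_path_lower_facet:
  assumes "a \<in> X" "set bs \<subseteq> X" "i < length bs"
  shows "take (Suc i) (cube_path br a bs) @ map (nie_y vert (cube_path br a bs) i) [Suc i..<length bs] =
    cube_path br a (take i bs @ drop (Suc i) bs)"
  using assms
proof (induction i arbitrary: a bs)
  case 0
  then obtain b bs' where bs: "bs = b # bs'" by (cases bs) auto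
  show ?case
  proof (rule nth_equalityI)
    fix m assume "m < length (take (Suc 0) (cube_path br a bs) @
      map (nie_y vert (cube_path br a bs) 0) [Suc 0..<length bs])"
    then show "(take (Suc 0) (cube_path br a bs) @
      map (nie_y vert (cube_path br a bs) 0) [Suc 0..<length bs]) ! m =
      cube_path br a (take 0 bs @ drop (Suc 0) bs) ! m"
      using 0 nie_y_0_cube_path[of a b bs' "m - 1"] by (cases m) (auto simp: bs simp del: upt_Suc)
  qed (simp add: bs del: upt_Suc)
next
  case (Suc i)
  then obtain b bs' where bs: "bs = b # bs'" by (cases bs) auto
  have "map (nie_y vert (a # as) (Suc i)) [Suc (Suc i)..<Suc n] = map (nie_y vert as i) [Suc i..<n]" for as n
    by (simp add: nie_y_Cons flip: map_Suc_upt del: upt_Suc)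
  then show ?case
    using Suc.IH[of b "map (br a b) bs'"] Suc.prems closed_map[of a b bs']
    by (simp add: bs take_map drop_map del: upt_Suc)
qed

text \<open>Here the facet consists of the subsets containing direction \<open>i + 1\<close>. Its base vertex has colour \<open>bs ! i\<close>, and its path
joins that of the cube at index \<open>i + 1\<close>. The vertices before it come from \<open>nie_y\<close>, which is computed
downwards from this junction; hence the induction exposes the first entry of the list as
\<open>vert a b\<close> of the next one.\<close>

lemma cube_path_upper_facet:
  assumes "a \<in> X" "set bs \<subseteq> X" "i < length bs"
  shows "map (nie_y vert (cube_path br a bs) i) [1..<Suc i] @ drop (Suc i) (cube_path br a bs) =
    cube_path br (bs ! i) (map (\<lambda>b. br a b (bs ! i)) (take i bs) @ map (br a (bs ! i)) (drop (Suc i) bs))"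
  using assms
proof (induction i arbitrary: a bs)
  case 0
  then obtain b bs' where bs: "bs = b # bs'" by (cases bs) auto
  show ?case by (simp add: bs)
next
  case (Suc i)
  then obtain b bs' where bs: "bs = b # bs'" by (cases bs) auto
  define c where "c = bs' ! i"
  define as where "as = cube_path br b (map (br a b) bs')"
  have X: "a \<in> X" "b \<in> X" "c \<in> X" "set bs' \<subseteq> X" "set (take i bs') \<subseteq> X" "set (drop (Suc i) bs') \<subseteq> X"
    using Suc.prems set_take_subset[of i bs'] set_drop_subset[of "Suc i" bs']
    by (auto simp: bs c_def)
  let ?R = "map (nie_y vert as i) [1..<Suc i] @ drop (Suc i) as"
  have "?R = cube_path br (br a b c) (map (\<lambda>d. br b (br a b d) (br a b c)) (take i bs')
      @ map (\<lambda>d. br b (br a b c) (br a b d)) (drop (Suc i) bs'))"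
    using Suc.IH[of b "map (br a b) bs'"] Suc.prems X closed_map[of a b bs']
    by (simp add: bs as_def c_def take_map drop_map comp_def del: upt_Suc)
  also have "map (\<lambda>d. br b (br a b d) (br a b c)) (take i bs') = map (\<lambda>d. br c (br a b c) (br a d c)) (take i bs')"
    using X by (intro map_cong refl H2_right) auto
  also have "map (\<lambda>d. br b (br a b c) (br a b d)) (drop (Suc i) bs') = map (\<lambda>d. br c (br a b c) (br a c d)) (drop (Suc i) bs')"
    using X by (intro map_cong refl H2_left) auto
  finally have R: "?R = cube_path br (br a b c)
      (map (\<lambda>d. br c (br a b c) (br a d c)) (take i bs') @ map (\<lambda>d. br c (br a b c) (br a c d)) (drop (Suc i) bs'))" .
  have "nie_y vert (a # as) (Suc i) 1 = vert a b (hd ?R)"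
  proof (cases i)
    case 0
    then show ?thesis
      using Suc.prems by (subst nie_y.simps) (simp add: as_def bs hd_drop_conv_nth)
  next
    case (Suc i')
    then have "nie_y vert (a # as) (Suc i) 1 = vert a b (nie_y vert (a # as) (Suc i) (Suc 1))"
      by (subst nie_y.simps) (simp add: as_def)
    then show ?thesis
      by (simp add: nie_y_Cons Suc upt_rec del: upt_Suc)
  qed
  then have "nie_y vert (a # as) (Suc i) 1 = c"
    unfolding R using X by (simp add: vert_br)
  moreover have "map (nie_y vert (a # as) (Suc i)) [1..<Suc (Suc i)] =
      nie_y vert (a # as) (Suc i) 1 # map (nie_y vert as i) [1..<Suc i]"
  proof -
    have "[1..<Suc (Suc i)] = 1 # map Suc [1..<Suc i]"
      by (simp add: map_Suc_upt upt_conv_Cons del: upt_Suc)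
    then show ?thesis
      by (simp add: nie_y_Cons del: upt_Suc)
  qed
  ultimately have "map (nie_y vert (a # as) (Suc i)) [1..<Suc (Suc i)] @ drop (Suc (Suc i)) (a # as) = c # ?R"
    by simp
  then show ?case
    unfolding R by (simp add: bs as_def c_def comp_def del: upt_Suc)
qed

text \<open>Vertex \<open>i + 1\<close> on the path is \<open>f {1..i+1}\<close>, and \<open>vert\<close> returns \<open>f {1, \<dots>, i, i+2}\<close>. The two agree iff \<open>f {i+1} = f {i+2}\<close>,
since each of the steps \<open>1, \<dots>, i\<close> applies one map \<open>br _ _\<close> to both, and these maps are injective.\<close>

lemma degenerate_cube_path:
  assumes "a \<in> X" "set bs \<subseteq> X" "Suc i < length bs"
  shows "vert (cube_path br a bs ! i) (cube_path br a bs ! Suc i) (cube_path br a bs ! Suc (Suc i)) =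
      cube_path br a bs ! Suc i \<longleftrightarrow> bs ! i = bs ! Suc i"
  using assms
proof (induction i arbitrary: a bs)
  case 0
  then obtain b c bs' where "bs = b # c # bs'"
    by (cases bs; cases "tl bs") auto
  then show ?case
    using 0 by (auto simp: vert_br)
next
  case (Suc i)
  then obtain b bs' where bs: "bs = b # bs'" by (cases bs) auto
  have "bs' ! i \<in> X" "bs' ! Suc i \<in> X"
    using Suc.prems by (auto simp: bs subset_iff)
  then show ?case
    using Suc.IH[of b "map (br a b) bs'"] Suc.prems closed_map[of a b bs']
    by (simp add: bs br_inj)
qed

lemma cube_path_inj:
  assumes "cube_path br a bs = cube_path br a' bs'" "a \<in> X" "set bs \<subseteq> X" "set bs' \<subseteq> X"
  shows "a = a' \<and> bs = bs'"
  using assms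
proof (induction "length bs" arbitrary: a bs a' bs')
  case 0
  then show ?case by (cases bs') (auto simp: cube_path_ne[THEN not_sym])
next
  case (Suc k)
  obtain b cs where bs: "bs = b # cs" using Suc.hyps(2) by (cases bs) auto
  with Suc.prems obtain b' cs' where bs': "bs' = b' # cs'" by (cases bs') auto
  have "a = a'" using Suc.prems(1) by (simp add: bs bs')
  moreover have "b = b' \<and> map (br a b) cs = map (br a b') cs'"
    using Suc.hyps(2) Suc.prems closed_map \<open>a = a'\<close>
    by (intro Suc.hyps(1)) (auto simp: bs bs')
  moreover have "inj_on (br a b) (set cs \<union> set cs')"
    using Suc.prems by (auto simp: inj_on_def bs bs' subset_iff br_inj)
  ultimately show ?case
    by (auto simp: bs bs' inj_on_map_eq_map)
qed

text \<open>The neighbours of the base vertex are recovered by undoing the maps \<open>br a b\<close>, from the end of the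
path backwards.\<close>

lemma cube_path_surj:
  assumes "as \<noteq> []" "set as \<subseteq> X"
  shows "\<exists>a bs. a \<in> X \<and> set bs \<subseteq> X \<and> as = cube_path br a bs"
  using assms
proof (induction as)
  case (Cons a as)
  show ?case
  proof (cases "as = []")
    case True
    then show ?thesis
      using Cons.prems by (intro exI[of _ a] exI[of _ "[]"]) auto
  next
    case False
    with Cons obtain b cs where b: "b \<in> X" "set cs \<subseteq> X" "as = cube_path br b cs"
      by auto
    then have "map (br a b) (map (vert a b) cs) = cs" "set (map (vert a b) cs) \<subseteq> X"
      using Cons.prems br_vert by (auto intro!: map_idI)
    then show ?thesis
      using Cons.prems b by (intro exI[of _ a] exI[of _ "b # map (vert a b) cs"]) auto
  qed
qed simp

end

section \<open>From local biquandle generators to Niebrzydowski generators\<close>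

definition cube_path_pairs :: "('x \<Rightarrow> 'x \<Rightarrow> 'x \<Rightarrow> 'x) \<Rightarrow> ('x \<times> 'x) list \<Rightarrow> 'x list" where
  "cube_path_pairs br ps = cube_path br (fst (hd ps)) (map snd ps)"

lemma cube_path_pairs_map_Pair [simp]:
  "bs \<noteq> [] \<Longrightarrow> cube_path_pairs br (map (Pair a) bs) = cube_path br a bs"
  by (simp add: cube_path_pairs_def hd_map comp_def)

lemma lb_basis_cases:
  assumes "ps \<in> lb_basis X n"
  obtains a bs where "ps = map (Pair a) bs" "a \<in> X" "set bs \<subseteq> X" "int (length bs) = n" "bs \<noteq> []"
proof -
  from assms obtain a bs where "ps = map (Pair a) bs" "a \<in> X" "set bs \<subseteq> X" "int (length bs) = n" "n \<ge> 1"
    by (auto simp: lb_basis_def split: if_splits)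
  then show thesis
    by (intro that[of a bs]) auto
qed

lemma lb_basisI:
  assumes "a \<in> X" "set bs \<subseteq> X" "int (length bs) = n" "n \<ge> 1"
  shows "map (Pair a) bs \<in> lb_basis X n"
  using assms by (auto simp: lb_basis_def)

context horizontal_tribracket
begin

lemma bij_betw_bases: "bij_betw (cube_path_pairs br) (lb_basis X n) (nie_basis X (n - 1))"
proof (rule bij_betw_imageI)
  show "inj_on (cube_path_pairs br) (lb_basis X n)"
  proof (rule inj_onI)
    fix ps qs assume "ps \<in> lb_basis X n" "qs \<in> lb_basis X n" "cube_path_pairs br ps = cube_path_pairs br qs"
    then show "ps = qs"
      by (elim lb_basis_cases) (auto dest: cube_path_inj)
  qed
  show "cube_path_pairs br ` lb_basis X n = nie_basis X (n - 1)"
  proof (intro subset_antisym subsetI)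
    fix as assume "as \<in> cube_path_pairs br ` lb_basis X n"
    then obtain a bs where "a \<in> X" "set bs \<subseteq> X" "int (length bs) = n" "bs \<noteq> []" "as = cube_path br a bs"
      by (auto elim!: lb_basis_cases)
    then show "as \<in> nie_basis X (n - 1)"
      using set_cube_path[of a bs] by (cases bs) (auto simp: nie_basis_def)
  next
    fix as assume as: "as \<in> nie_basis X (n - 1)"
    then have "as \<noteq> []" "set as \<subseteq> X" and n: "n \<ge> 1" "int (length as) = n + 1"
      by (auto simp: nie_basis_def split: if_splits)
    then obtain a bs where a: "a \<in> X" "set bs \<subseteq> X" "as = cube_path br a bs"
      using cube_path_surj by blast
    then show "as \<in> cube_path_pairs br ` lb_basis X n"
      using n by (intro image_eqI[of _ _ "map (Pair a) bs"] lb_basisI) (auto simp: Suc_le_eq)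
  qed
qed

text \<open>This is \<open>degenerate_cube_path\<close> up to a shift of index: positions in lists start at \<open>0\<close>, while \<open>j\<close>
starts at \<open>1\<close>.\<close>

lemma degenerate_cube_path_pairs:
  assumes "ps \<in> lb_basis X n"
  shows "(\<exists>j. 1 \<le> j \<and> int j \<le> n - 1 \<and>
      vert (cube_path_pairs br ps ! (j - 1)) (cube_path_pairs br ps ! j) (cube_path_pairs br ps ! (j + 1)) =
      cube_path_pairs br ps ! j)
    \<longleftrightarrow> (\<exists>i. Suc i < length ps \<and> snd (ps ! i) = snd (ps ! Suc i))"
  using assms
proof (rule lb_basis_cases)
  fix a bs assume ps: "ps = map (Pair a) bs" "a \<in> X" "set bs \<subseteq> X" "int (length bs) = n" "bs \<noteq> []"
  have "(\<exists>j. 1 \<le> j \<and> int j \<le> n - 1 \<and> P j) \<longleftrightarrow> (\<exists>i. Suc i < length bs \<and> P (Suc i))" for P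
  proof
    assume "\<exists>j. 1 \<le> j \<and> int j \<le> n - 1 \<and> P j"
    then obtain j where "1 \<le> j" "int j \<le> n - 1" "P j" by blast
    then show "\<exists>i. Suc i < length bs \<and> P (Suc i)"
      using ps(4) by (intro exI[of _ "j - 1"]) auto
  next
    assume "\<exists>i. Suc i < length bs \<and> P (Suc i)"
    then obtain i where "Suc i < length bs" "P (Suc i)" by blast
    then show "\<exists>j. 1 \<le> j \<and> int j \<le> n - 1 \<and> P j"
      using ps(4) by (intro exI[of _ "Suc i"]) auto
  qed
  then show ?thesis
    using ps degenerate_cube_path[OF ps(2,3)] by (auto simp: ps(1))
qed

lemma image_lb_degenerate:
  "frag_extend (frag_of \<circ> cube_path_pairs br) ` lb_degenerate X n = nie_degenerate X vert (n - 1)"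
proof -
  let ?\<Phi> = "frag_extend (frag_of \<circ> cube_path_pairs br)"
  let ?L = "{ps \<in> lb_basis X n. \<exists>i. Suc i < length ps \<and> snd (ps ! i) = snd (ps ! Suc i)}"
  let ?N = "{as \<in> nie_basis X (n - 1). \<exists>j. 1 \<le> j \<and> int j \<le> n - 1 \<and>
      vert (as ! (j - 1)) (as ! j) (as ! (j + 1)) = as ! j}"
  have "?\<Phi> ` lb_degenerate X n = generate (nie_chain X (n - 1)) (?\<Phi> ` frag_of ` ?L)"
    unfolding lb_degenerate_def lb_chain_def nie_chain_def
    using frag_extend_iso[OF bij_betw_bases]
    by (intro image_generate) (auto simp: iso_def)
  also have "?\<Phi> ` frag_of ` ?L = frag_of ` cube_path_pairs br ` ?L"
    by (simp add: image_image)
  also have "cube_path_pairs br ` ?L = ?N"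
  proof -
    have "?N = {as \<in> cube_path_pairs br ` lb_basis X n. \<exists>j. 1 \<le> j \<and> int j \<le> n - 1 \<and>
      vert (as ! (j - 1)) (as ! j) (as ! (j + 1)) = as ! j}"
      using bij_betw_imp_surj_on[OF bij_betw_bases] by simp
    also have "\<dots> = cube_path_pairs br ` ?L"
      using degenerate_cube_path_pairs by blast
    finally show ?thesis by (rule sym)
  qed
  finally show ?thesis
    unfolding nie_degenerate_def .
qed

end

section \<open>The boundary of a cube\<close>

lemma free_subgroup_cmul_sign:
  assumes "subgroup D (free_Abelian_group S)" "x \<in> D"
  shows "frag_cmul ((- 1) ^ k) x \<in> D"
proof -
  have "- x \<in> D"
    using subgroup.m_inv_closed[OF assms] subgroup.mem_carrier[OF assms] by simp
  then show ?thesis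
    using assms(2) by (cases "even k") auto
qed

lemma free_subgroup_diff:
  assumes "subgroup D (free_Abelian_group S)" "x \<in> D" "y \<in> D"
  shows "x - y \<in> D"
proof -
  have "x + (- y) \<in> D"
    using subgroup.m_closed[OF assms(1,2)] subgroup.m_inv_closed[OF assms(1,3)] subgroup.mem_carrier[OF assms(1,3)]
    by force
  then show ?thesis by simp
qed

lemma free_subgroup_sum:
  assumes "subgroup D (free_Abelian_group S)" "\<And>i. i \<in> I \<Longrightarrow> f i \<in> D"
  shows "sum f I \<in> D"
  using assms(2)
proof (induction I rule: infinite_finite_induct)
  case (insert i I)
  then show ?case
    using subgroup.m_closed[OF assms(1), of "f i" "sum f I"] by simp
qed (use subgroup.one_closed[OF assms(1)] in auto)

definition has_repetition :: "'z list \<Rightarrow> bool" where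
  "has_repetition xs \<longleftrightarrow> (\<exists>i. Suc i < length xs \<and> xs ! i = xs ! Suc i)"

text \<open>A facet in a direction other than the two repeated ones keeps both. The deleted position \<open>m\<close> is never
between them, so one of \<open>f\<close> and \<open>g\<close> acts on both.\<close>

lemma has_repetition_delete:
  assumes "Suc i < length xs" "xs ! i = xs ! Suc i" "m < length xs" "m \<noteq> i" "m \<noteq> Suc i"
  shows "has_repetition (map f (take m xs) @ map g (drop (Suc m) xs))"
proof (cases "m < i")
  case True
  then have "Suc (i - 1) = i" "\<not> i - 1 < m" "Suc (m + (i - 1 - m)) = i" "Suc (m + (i - m)) = Suc i"
    by auto
  then show ?thesis
    unfolding has_repetition_def using assms True by (intro exI[of _ "i - 1"]) (auto simp: nth_append min_def)
next
  case False
  then show ?thesis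
    unfolding has_repetition_def using assms by (intro exI[of _ i]) (auto simp: nth_append)
qed

text \<open>The copy that remains stands after the gap in one list and before it in the other, so \<open>f\<close> and \<open>g\<close>
have to agree on it.\<close>

lemma delete_repeated:
  assumes "Suc i < length xs" "xs ! i = xs ! Suc i" "f (xs ! i) = g (xs ! i)"
  shows "map f (take i xs) @ map g (drop (Suc i) xs) = map f (take (Suc i) xs) @ map g (drop (Suc (Suc i)) xs)"
proof -
  have "drop (Suc i) xs = xs ! Suc i # drop (Suc (Suc i)) xs"
    using assms(1) by (simp add: Cons_nth_drop_Suc)
  then show ?thesis
    using assms by (simp add: take_Suc_conv_app_nth)
qed

context horizontal_tribracket
begin

lemma lb_facets:
  assumes "a \<in> X" "set bs \<subseteq> X" "i < length bs" "int (length bs) = n" "n \<ge> 2"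
  shows "map (Pair a) (take i bs @ drop (Suc i) bs) \<in> lb_basis X (n - 1)"
    and "map (Pair (bs ! i)) (map (\<lambda>b. br a b (bs ! i)) (take i bs) @ map (br a (bs ! i)) (drop (Suc i) bs))
      \<in> lb_basis X (n - 1)"
proof -
  have "set (take i bs) \<subseteq> X" "set (drop (Suc i) bs) \<subseteq> X" "bs ! i \<in> X"
    using assms set_take_subset[of i bs] set_drop_subset[of "Suc i" bs] by auto
  moreover from this have "set (map (\<lambda>b. br a b (bs ! i)) (take i bs)) \<subseteq> X"
    "set (map (br a (bs ! i)) (drop (Suc i) bs)) \<subseteq> X"
    using assms closed by auto
  ultimately show "map (Pair a) (take i bs @ drop (Suc i) bs) \<in> lb_basis X (n - 1)"
    "map (Pair (bs ! i)) (map (\<lambda>b. br a b (bs ! i)) (take i bs) @ map (br a (bs ! i)) (drop (Suc i) bs))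
      \<in> lb_basis X (n - 1)"
    using assms by (intro lb_basisI; simp)+
qed

definition lb_facet_difference where
  "lb_facet_difference a bs i =
    frag_of (map (Pair a) (take i bs @ drop (Suc i) bs))
    - frag_of (map (Pair (bs ! i)) (map (\<lambda>b. br a b (bs ! i)) (take i bs) @ map (br a (bs ! i)) (drop (Suc i) bs)))"

lemma lb_boundary_basis_facets:
  "lb_boundary_basis br (map (Pair a) bs) =
    (\<Sum>i<length bs. frag_cmul ((- 1) ^ Suc i) (lb_facet_difference a bs i))"
  unfolding lb_boundary_basis_explicit lb_facet_difference_def
  by (rule sum.reindex_bij_witness[of _ Suc "\<lambda>i. i - 1"]) (auto simp: comp_def)

lemma keys_lb_boundary_basis:
  assumes "ps \<in> lb_basis X n" "n \<ge> 2"
  shows "Poly_Mapping.keys (lb_boundary_basis br ps) \<subseteq> lb_basis X (n - 1)"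
  using assms(1)
proof (rule lb_basis_cases)
  fix a bs assume ps: "ps = map (Pair a) bs" "a \<in> X" "set bs \<subseteq> X" "int (length bs) = n"
  have "Poly_Mapping.keys (lb_facet_difference a bs i) \<subseteq> lb_basis X (n - 1)" if "i < length bs" for i
    using lb_facets[OF ps(2,3) that ps(4) assms(2)] unfolding lb_facet_difference_def
    by (intro order_trans[OF keys_diff]) auto
  then show ?thesis
    unfolding ps(1) lb_boundary_basis_facets
    by (intro order_trans[OF keys_sum] UN_least order_trans[OF keys_cmul]) auto
qed

text \<open>Term by term, the removal of the \<open>i\<close>-th pair is a lower facet and the second local biquandle term an
upper facet. The first boundary counts directions from \<open>1\<close> and takes lower minus upper; the second
counts from \<open>0\<close> and takes upper minus lower. The two changes of sign cancel, so the bases correspond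
without signs.\<close>

lemma cube_path_pairs_boundary:
  assumes "ps \<in> lb_basis X n" "n \<ge> 2"
  shows "frag_extend (frag_of \<circ> cube_path_pairs br) (lb_boundary_basis br ps) =
    nie_boundary_basis vert (cube_path_pairs br ps)"
  using assms(1)
proof (rule lb_basis_cases)
  fix a bs assume ps: "ps = map (Pair a) bs" "a \<in> X" "set bs \<subseteq> X" "int (length bs) = n" "bs \<noteq> []"
  let ?as = "cube_path br a bs"
  have facet: "frag_extend (frag_of \<circ> cube_path_pairs br) (lb_facet_difference a bs i) =
      frag_of (take (Suc i) ?as @ map (nie_y vert ?as i) [Suc i..<length bs])
      - frag_of (map (nie_y vert ?as i) [1..<Suc i] @ drop (Suc i) ?as)" if "i < length bs" for i
  proof -
    have "take i bs @ drop (Suc i) bs \<noteq> []"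
      using ps(4) assms(2) that by auto
    then show ?thesis
      unfolding cube_path_lower_facet[OF ps(2,3) that] cube_path_upper_facet[OF ps(2,3) that] lb_facet_difference_def
      by (simp add: frag_extend_diff cube_path_pairs_map_Pair del: map_append map_map append_is_Nil_conv)
         (simp add: cube_path_pairs_map_Pair del: map_append)
  qed
  have "frag_extend (frag_of \<circ> cube_path_pairs br) (lb_boundary_basis br ps) =
    (\<Sum>i<length bs. frag_cmul ((- 1) ^ Suc i) (frag_of (take (Suc i) ?as @ map (nie_y vert ?as i) [Suc i..<length bs])
      - frag_of (map (nie_y vert ?as i) [1..<Suc i] @ drop (Suc i) ?as)))"
    unfolding ps(1) lb_boundary_basis_facets
    by (subst frag_extend_sum, simp, rule sum.cong) (simp_all only: o_apply frag_extend_cmul lessThan_iff facet)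
  also have "\<dots> = (\<Sum>i = 0..length bs - 1. frag_cmul ((- 1) ^ i)
      (frag_of (map (nie_y vert ?as i) [1..<i + 1] @ drop (i + 1) ?as)
        - frag_of (take (i + 1) ?as @ map (nie_y vert ?as i) [i + 1..<length bs - 1 + 1])))"
  proof (rule sum.cong)
    show "{..<length bs} = {0..length bs - 1}"
      using ps(5) by (cases bs) auto
    have flip: "frag_cmul (- c) (x - y) = frag_cmul c (y - x)" for c and x y :: "'x list \<Rightarrow>\<^sub>0 int"
      by (rule poly_mapping_eqI) (simp add: lookup_minus algebra_simps)
    fix i assume "i \<in> {0..length bs - 1}"
    show "frag_cmul ((- 1) ^ Suc i) (frag_of (take (Suc i) ?as @ map (nie_y vert ?as i) [Suc i..<length bs])
      - frag_of (map (nie_y vert ?as i) [1..<Suc i] @ drop (Suc i) ?as)) = frag_cmul ((- 1) ^ i)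
      (frag_of (map (nie_y vert ?as i) [1..<i + 1] @ drop (i + 1) ?as)
        - frag_of (take (i + 1) ?as @ map (nie_y vert ?as i) [i + 1..<length bs - 1 + 1]))"
      using ps(5) by (simp add: flip del: upt_Suc)
  qed
  also have "\<dots> = nie_boundary_basis vert (cube_path_pairs br ps)"
    using ps(5) by (simp add: nie_boundary_basis_def ps(1) del: upt_Suc)
  finally show ?thesis .
qed

lemma lb_degenerate_subgroup: "subgroup (lb_degenerate X n) (lb_chain X n)"
  unfolding lb_degenerate_def lb_chain_def
  by (intro group.generate_is_subgroup) auto

text \<open>Facets in the two repeated directions are equal and enter with opposite signs; all others are degenerate.\<close>

lemma lb_boundary_basis_degenerate:
  assumes "ps \<in> lb_basis X n" "n \<ge> 2" "\<exists>i. Suc i < length ps \<and> snd (ps ! i) = snd (ps ! Suc i)"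
  shows "lb_boundary_basis br ps \<in> lb_degenerate X (n - 1)"
  using assms(1)
proof (rule lb_basis_cases)
  fix a bs assume ps: "ps = map (Pair a) bs" "a \<in> X" "set bs \<subseteq> X" "int (length bs) = n"
  from assms(3) obtain i where i: "Suc i < length bs" "bs ! i = bs ! Suc i"
    by (auto simp: ps(1))
  let ?D = "lb_degenerate X (n - 1)"
  let ?f = "\<lambda>i. frag_cmul ((- 1) ^ Suc i) (lb_facet_difference a bs i)"
  note D = lb_degenerate_subgroup[of "n - 1", unfolded lb_chain_def]
  have rep: "frag_of (map (Pair c) cs) \<in> ?D"
    if "map (Pair c) cs \<in> lb_basis X (n - 1)" "has_repetition cs" for c cs
    unfolding lb_degenerate_def using that
    by (intro generate.incl imageI) (auto simp: has_repetition_def)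
  have "?f m \<in> ?D" if "m \<in> {..<length bs} - {i, Suc i}" for m
  proof -
    have m: "m < length bs" "m \<noteq> i" "m \<noteq> Suc i" using that by auto
    have "has_repetition (take m bs @ drop (Suc m) bs)"
      using has_repetition_delete[OF i m, of id id] by simp
    then show ?thesis
      unfolding lb_facet_difference_def
      by (intro free_subgroup_cmul_sign[OF D] free_subgroup_diff[OF D] rep has_repetition_delete[OF i m]
          lb_facets[OF ps(2,3) m(1) ps(4) assms(2)])
  qed
  then have "sum ?f ({..<length bs} - {i, Suc i}) \<in> ?D"
    by (rule free_subgroup_sum[OF D])
  moreover have "lb_facet_difference a bs i = lb_facet_difference a bs (Suc i)"
    using delete_repeated[OF i, of id id] delete_repeated[OF i, of "\<lambda>b. br a b (bs ! i)" "br a (bs ! i)"]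
    by (simp add: lb_facet_difference_def i(2))
  then have "sum ?f {i, Suc i} = 0"
    by (simp flip: frag_cmul_distrib)
  moreover have "sum ?f {..<length bs} = sum ?f ({..<length bs} - {i, Suc i}) + sum ?f {i, Suc i}"
    using i by (intro sum.subset_diff) auto
  ultimately show ?thesis
    by (simp add: ps(1) lb_boundary_basis_facets)
qed

lemma lb_boundary_degenerate: "lb_boundary br n ` lb_degenerate X n \<subseteq> lb_degenerate X (n - 1)"
proof (cases "n \<ge> 2")
  case True
  let ?L = "{ps \<in> lb_basis X n. \<exists>i. Suc i < length ps \<and> snd (ps ! i) = snd (ps ! Suc i)}"
  have "frag_extend (lb_boundary_basis br) \<in> hom (lb_chain X n) (lb_chain X (n - 1))"
    using keys_lb_boundary_basis True unfolding lb_chain_def by (intro frag_extend_hom)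
  then have "lb_boundary br n ` lb_degenerate X n = generate (lb_chain X (n - 1)) (lb_boundary_basis br ` ?L)"
    using True image_generate[of "lb_chain X n" "lb_chain X (n - 1)" "frag_extend (lb_boundary_basis br)" "frag_of ` ?L"]
    by (simp add: lb_boundary_def lb_degenerate_def lb_chain_def image_image image_subset_iff)
  also have "\<dots> \<subseteq> lb_degenerate X (n - 1)"
    using lb_boundary_basis_degenerate True lb_degenerate_subgroup
    by (intro group.generate_subgroup_incl) (auto simp: lb_chain_def)
  finally show ?thesis .
next
  case False
  then show ?thesis
    using subgroup.one_closed[OF lb_degenerate_subgroup[of "n - 1"]] by (auto simp: lb_boundary_def lb_chain_def)
qed

end

section \<open>The isomorphism of complexes\<close>

context horizontal_tribracket
begin

lemma chain_complex_iso:
  "complex_iso (lb_chain X) (lb_boundary br) (\<lambda>n. nie_chain X (n - 1)) (\<lambda>n. nie_boundary vert (n - 1))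
    (\<lambda>n. frag_extend (frag_of \<circ> cube_path_pairs br))"
proof -
  \<comment> \<open>Both boundaries vanish for \<open>n < 2\<close>; with this case moved into the values on basis elements, both are
    linear extensions in every degree.\<close>
  define g where "g = (\<lambda>n::int. if n \<ge> 2 then lb_boundary_basis br else (\<lambda>_. 0))"
  define g' where "g' = (\<lambda>n::int. if n \<ge> 2 then nie_boundary_basis vert else (\<lambda>_. 0))"
  have zero: "frag_extend (\<lambda>_. 0) x = 0" for x :: "'z \<Rightarrow>\<^sub>0 int"
    by (rule frag_extend_eq_0) auto
  have "complex_iso (\<lambda>n. free_Abelian_group (lb_basis X n)) (\<lambda>n. frag_extend (g n))
    (\<lambda>n. free_Abelian_group (nie_basis X (n - 1))) (\<lambda>n. frag_extend (g' n))
    (\<lambda>n. frag_extend (frag_of \<circ> cube_path_pairs br))"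
    by (rule free_complex_iso[where S = "lb_basis X" and T = "\<lambda>n. nie_basis X (n - 1)"
          and \<phi> = "\<lambda>n. cube_path_pairs br" and g = g and g' = g'])
       (use bij_betw_bases keys_lb_boundary_basis cube_path_pairs_boundary in \<open>auto simp: g_def g'_def zero\<close>)
  moreover have "lb_boundary br = (\<lambda>n. frag_extend (g n))" "(\<lambda>n. nie_boundary vert (n - 1)) = (\<lambda>n. frag_extend (g' n))"
    by (auto simp: lb_boundary_def nie_boundary_def g_def g'_def zero intro!: ext)
  moreover have "lb_chain X = (\<lambda>n. free_Abelian_group (lb_basis X n))"
    "(\<lambda>n. nie_chain X (n - 1)) = (\<lambda>n. free_Abelian_group (nie_basis X (n - 1)))"
    by (auto simp: lb_chain_def nie_chain_def)
  ultimately show ?thesis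
    by simp
qed

lemma quotient_complexes_iso:
  "complex_iso (lb_groups X) (lb_diff X br) (\<lambda>n. nie_groups X vert (n - 1)) (\<lambda>n. nie_diff X vert (n - 1))
    (\<lambda>n. (`) (frag_extend (frag_of \<circ> cube_path_pairs br)))"
proof -
  interpret complex_iso "lb_chain X" "lb_boundary br" "\<lambda>n. nie_chain X (n - 1)" "\<lambda>n. nie_boundary vert (n - 1)"
    "\<lambda>n. frag_extend (frag_of \<circ> cube_path_pairs br)"
    by (rule chain_complex_iso)
  show ?thesis
    using quotient_complex_iso[where D = "lb_degenerate X" and D' = "\<lambda>n. nie_degenerate X vert (n - 1)",
        OF lb_degenerate_subgroup lb_boundary_degenerate image_lb_degenerate]
    by (simp add: quotient_groups_def[abs_def] quotient_boundary_def[abs_def])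
qed

end

text \<open>The isomorphism of complexes relates degree \<open>n\<close> to degree \<open>n - 1\<close>; reindexing a complex reindexes
its homology.\<close>

lemma homology_coeff_shift:
  "homology_coeff (\<lambda>n. C (n - 1)) (\<lambda>n. d (n - 1)) A n = homology_coeff C d A (n - 1)"
  by (simp add: homology_coeff_def homology_def)

lemma cohomology_coeff_shift:
  "cohomology_coeff (\<lambda>n. C (n - 1)) (\<lambda>n. d (n - 1)) A n = cohomology_coeff C d A (n - 1)"
  by (simp add: cohomology_coeff_def cohomology_def)

theorem theorem4p2:
  fixes X :: "'x set" and br :: "'x \<Rightarrow> 'x \<Rightarrow> 'x \<Rightarrow> 'x"
    and A :: "('a, 'k) monoid_scheme" and n :: int
  assumes "horizontal_tribracket X br" and "comm_group A"
  shows "lb_homology X br A n \<cong> nie_homology X (vertical_tribracket X br) A (n - 1) \<and>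
    lb_cohomology X br A n \<cong> nie_cohomology X (vertical_tribracket X br) A (n - 1)"
proof
  interpret horizontal_tribracket X br by fact
  interpret A: comm_group A by fact
  note iso = quotient_complexes_iso
  show "lb_homology X br A n \<cong> nie_homology X vert A (n - 1)"
    using complex_iso.homology_coeff_iso[OF iso A.is_group, of n]
    by (simp add: lb_homology_def nie_homology_def homology_coeff_shift)
  show "lb_cohomology X br A n \<cong> nie_cohomology X vert A (n - 1)"
    using complex_iso.cohomology_coeff_iso[OF complex_iso.inverse[OF iso] assms(2), of n]
    by (simp add: lb_cohomology_def nie_cohomology_def cohomology_coeff_shift)
qed

end
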